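(* Let $A$ be a Banach algebra with product $\pi:A\times A\to A$, let $(\pi_{1},X,\pi_2)$ be a Banach $A$-module and let $D:A\times A\times A\to X$ be a tri-derivation. Then $D^{****}:(A^{**},\square)\times (A^{**},\square)\times (A^{**},\square)\to X^{**}$ is a tri-derivation (where $X^{**}$ carries the module actions $\pi_1^{***}$ and $\pi_2^{***}$ of $(A^{**},\square)$) if and only if all of the following hold: (1) $\pi_{2}^{**r*}(D^{****}(A,A,A^{**}),X^{*})\subseteq A^{*}$, (2) $\pi_{2}^{****}(X^{*},D^{****}(A,A^{**},A^{**}))\subseteq A^{*}$, (3) $D^{****r*}(\pi_{1}^{****}(X^{*},A^{**}),A^{**},A^{**})\subseteq A^{*}$, (4) $D^{******}(A^{**},\pi_{1}^{****}(X^{*},A^{**}),A)\subseteq A^{*}$, (5) $D^{*******}(A^{**},A^{**},\pi_{1}^{****}(X^{*},A^{**}))\subseteq A^{*}$.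
   Context: Every normed space is identified with its canonical image in its second dual (so $A\subseteq A^{**}\subseteq A^{****}$, $A^*\subseteq A^{***}$, $X^*\subseteq X^{***}$). Adjoints. For a bounded bilinear map $m:X\times Y\to Z$ of normed spaces, $m^{*}:Z^{*}\times X\to Y^{*}$ is defined by $\langle m^{*}(z^{*},x),y\rangle=\langle z^{*},m(x,y)\rangle$; iterating, $m^{**}=(m^* )^*:Y^{**}\times Z^{*}\to X^{*}$, $m^{***}=(m^{**})^*:X^{**}\times Y^{**}\to Z^{**}$, etc.; the flip is $m^{r}(y,x)=m(x,y)$. For a bounded tri-linear map $f:X\times Y\times Z\to W$, $f^{*}:W^{*}\times X\times Y\to Z^{*}$ is defined by $\langle f^{*}(w^{*},x,y),z\rangle=\langle w^{*},f(x,y,z)\rangle$; iterating, $f^{**}=(f^* )^*:Z^{**}\times W^{*}\times X\to Y^{*}$, $f^{***}:Y^{**}\times Z^{**}\times W^{*}\to X^{*}$, $f^{****}:X^{**}\times Y^{**}\times Z^{**}\to W^{**}$, etc.; the flip is $f^{r}(z,y,x)=f(x,y,z)$. Strings of $*$ and $r$ in a superscript are applied from left to right. Thus here $\pi_2^{**r*}:X^{**}\times X^{*}\to A^{***}$, $\pi_2^{****}:X^{***}\times X^{**}\to A^{***}$, $\pi_1^{****}:X^{***}\times A^{**}\to X^{***}$, $D^{****r*}:X^{***}\times A^{**}\times A^{**}\to A^{***}$, $D^{******}:A^{****}\times X^{***}\times A^{**}\to A^{***}$, $D^{*******}:A^{****}\times A^{****}\times X^{***}\to A^{***}$. For a map $F$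 and sets $P,Q,\dots$, $F(P,Q,\dots)$ denotes the set of values of $F$ on elements of these sets. First Arens product: $a^{**}\square b^{**}=\pi^{***}(a^{**},b^{**})$ on $A^{**}$. Banach module. $(\pi_1,X,\pi_2)$ is a Banach $A$-module if $X$ is a Banach space, $\pi_1:A\times X\to X$ and $\pi_2:X\times A\to X$ are bounded bilinear, and for all $a,b\in A$, $x\in X$: $\pi_1(\pi(a,b),x)=\pi_1(a,\pi_1(b,x))$, $\pi_2(x,\pi(a,b))=\pi_2(\pi_2(x,a),b)$, $\pi_1(a,\pi_2(x,b))=\pi_2(\pi_1(a,x),b)$. Tri-derivation. A bounded tri-linear map $D:A\times A\times A\to X$ is a tri-derivation if for all $a,b,c,d\in A$: $D(\pi(a,d),b,c)=\pi_2(D(a,b,c),d)+\pi_1(a,D(d,b,c))$; $D(a,\pi(b,d),c)=\pi_2(D(a,b,c),d)+\pi_1(b,D(a,d,c))$; $D(a,b,\pi(c,d))=\pi_2(D(a,b,c),d)+\pi_1(c,D(a,b,d))$. That $D^{****}$ is a tri-derivation on $(A^{**},\square)$ means that the same three identities hold with $A,\pi,\pi_1,\pi_2,D$ replaced by $A^{**},\pi^{***},\pi_1^{***},\pi_2^{***},D^{****}$. *)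

theory Defs
  imports Complex_Main "HOL-Library.Function_Algebras"
begin

text \<open>
  The library has real normed spaces only, and its dual space is a type of real-linear maps.
  To treat real and complex scalars alike, a normed space is given here by a subspace of
  an ambient abelian group, the action of the scalars, and a norm on the subspace. The scalars
  form a type of class \<open>real_normed_field\<close>, that is (Gelfand-Mazur) the real or the complex field.
\<close>

record ('k, 'a) nspace =
  carr :: "'a set"
  scl :: "'k \<Rightarrow> 'a \<Rightarrow> 'a"
  nrm :: "'a \<Rightarrow> real"

definition normed_space :: "('k::real_normed_field, 'a::ab_group_add) nspace \<Rightarrow> bool" where
  "normed_space V \<longleftrightarrow>
     vector_space (scl V) \<and> module.subspace (scl V) (carr V) \<and>
     (\<forall>x\<in>carr V. nrm V x = 0 \<longleftrightarrow> x = 0) \<and>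
     (\<forall>x\<in>carr V. \<forall>y\<in>carr V. nrm V (x + y) \<le> nrm V x + nrm V y) \<and>
     (\<forall>c. \<forall>x\<in>carr V. nrm V (scl V c x) = norm c * nrm V x)"

definition banach_space :: "('k::real_normed_field, 'a::ab_group_add) nspace \<Rightarrow> bool" where
  "banach_space V \<longleftrightarrow> normed_space V \<and>
     (\<forall>s :: nat \<Rightarrow> 'a. range s \<subseteq> carr V \<longrightarrow>
        (\<forall>e>0. \<exists>N. \<forall>m\<ge>N. \<forall>n\<ge>N. nrm V (s m - s n) < e) \<longrightarrow>
        (\<exists>l\<in>carr V. (\<lambda>n. nrm V (s n - l)) \<longlonglongrightarrow> 0))"

definition linear_map ::
  "('k::real_normed_field, 'a::ab_group_add) nspace \<Rightarrow> ('k, 'b::ab_group_add) nspace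
     \<Rightarrow> ('a \<Rightarrow> 'b) \<Rightarrow> bool" where
  "linear_map V W f \<longleftrightarrow>
     (\<forall>x\<in>carr V. f x \<in> carr W) \<and>
     (\<forall>x\<in>carr V. \<forall>y\<in>carr V. f (x + y) = f x + f y) \<and>
     (\<forall>c. \<forall>x\<in>carr V. f (scl V c x) = scl W c (f x))"

definition scalars :: "('k::real_normed_field, 'k) nspace" where
  "scalars = \<lparr>carr = UNIV, scl = (*), nrm = norm\<rparr>"

text \<open>
  The elements of the dual space are the bounded linear functionals on the carrier, extended
  by \<open>0\<close> to the ambient type, so that equality of functionals is equality of functions.
  The sum of functionals is the pointwise sum of functions.
\<close>

definition dual :: "('k::real_normed_field, 'a::ab_group_add) nspace \<Rightarrow> ('k, 'a \<Rightarrow> 'k) nspace" where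
  "dual V = \<lparr>
     carr = {f. linear_map V scalars f \<and>
                (\<exists>B. \<forall>x\<in>carr V. norm (f x) \<le> B * nrm V x) \<and>
                (\<forall>x. x \<notin> carr V \<longrightarrow> f x = 0)},
     scl = (\<lambda>c f x. c * f x),
     nrm = (\<lambda>f. Sup {norm (f x) | x. x \<in> carr V \<and> nrm V x \<le> 1})\<rparr>"

abbreviation "bidual V \<equiv> dual (dual V)"

definition emb :: "('k::real_normed_field, 'a::ab_group_add) nspace \<Rightarrow> 'a \<Rightarrow> ('a \<Rightarrow> 'k) \<Rightarrow> 'k" where
  "emb V x = (\<lambda>f. if f \<in> carr (dual V) then f x else 0)"

text \<open>The space \<open>V\<close>, regarded as a subset of its second dual.\<close>

definition canon :: "('k::real_normed_field, 'a::ab_group_add) nspace \<Rightarrow> (('a \<Rightarrow> 'k) \<Rightarrow> 'k) set" where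
  "canon V = emb V ` carr V"

text \<open>
  Bilinear and tri-linear maps are bundled with their domains and codomain, as the spaces
  are needed to form the adjoints.
\<close>

record ('k, 'x, 'y, 'z) bimap =
  bdom1 :: "('k, 'x) nspace"
  bdom2 :: "('k, 'y) nspace"
  bcod :: "('k, 'z) nspace"
  bap :: "'x \<Rightarrow> 'y \<Rightarrow> 'z"

record ('k, 'x, 'y, 'z, 'w) trimap =
  tdom1 :: "('k, 'x) nspace"
  tdom2 :: "('k, 'y) nspace"
  tdom3 :: "('k, 'z) nspace"
  tcod :: "('k, 'w) nspace"
  tap :: "'x \<Rightarrow> 'y \<Rightarrow> 'z \<Rightarrow> 'w"

definition bounded_bilinear_maps ::
  "('k::real_normed_field, 'x::ab_group_add) nspace \<Rightarrow> ('k, 'y::ab_group_add) nspace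
     \<Rightarrow> ('k, 'z::ab_group_add) nspace \<Rightarrow> ('k, 'x, 'y, 'z) bimap set" where
  "bounded_bilinear_maps X Y Z = {m.
     bdom1 m = X \<and> bdom2 m = Y \<and> bcod m = Z \<and>
     (\<forall>y\<in>carr Y. linear_map X Z (\<lambda>x. bap m x y)) \<and>
     (\<forall>x\<in>carr X. linear_map Y Z (\<lambda>y. bap m x y)) \<and>
     (\<exists>B. \<forall>x\<in>carr X. \<forall>y\<in>carr Y. nrm Z (bap m x y) \<le> B * nrm X x * nrm Y y)}"

definition bounded_trilinear_maps ::
  "('k::real_normed_field, 'x::ab_group_add) nspace \<Rightarrow> ('k, 'y::ab_group_add) nspace
     \<Rightarrow> ('k, 'z::ab_group_add) nspace \<Rightarrow> ('k, 'w::ab_group_add) nspace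
     \<Rightarrow> ('k, 'x, 'y, 'z, 'w) trimap set" where
  "bounded_trilinear_maps X Y Z W = {f.
     tdom1 f = X \<and> tdom2 f = Y \<and> tdom3 f = Z \<and> tcod f = W \<and>
     (\<forall>y\<in>carr Y. \<forall>z\<in>carr Z. linear_map X W (\<lambda>x. tap f x y z)) \<and>
     (\<forall>x\<in>carr X. \<forall>z\<in>carr Z. linear_map Y W (\<lambda>y. tap f x y z)) \<and>
     (\<forall>x\<in>carr X. \<forall>y\<in>carr Y. linear_map Z W (\<lambda>z. tap f x y z)) \<and>
     (\<exists>B. \<forall>x\<in>carr X. \<forall>y\<in>carr Y. \<forall>z\<in>carr Z.
        nrm W (tap f x y z) \<le> B * nrm X x * nrm Y y * nrm Z z)}"

definition badj ::
  "('k::real_normed_field, 'x::ab_group_add, 'y::ab_group_add, 'z::ab_group_add) bimap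
     \<Rightarrow> ('k, 'z \<Rightarrow> 'k, 'x, 'y \<Rightarrow> 'k) bimap" where
  "badj m = \<lparr>bdom1 = dual (bcod m), bdom2 = bdom1 m, bcod = dual (bdom2 m),
     bap = (\<lambda>z' x y. if y \<in> carr (bdom2 m) then z' (bap m x y) else 0)\<rparr>"

definition bflip :: "('k, 'x, 'y, 'z) bimap \<Rightarrow> ('k, 'y, 'x, 'z) bimap" where
  "bflip m = \<lparr>bdom1 = bdom2 m, bdom2 = bdom1 m, bcod = bcod m, bap = (\<lambda>y x. bap m x y)\<rparr>"

definition tadj ::
  "('k::real_normed_field, 'x::ab_group_add, 'y::ab_group_add, 'z::ab_group_add,
     'w::ab_group_add) trimap
     \<Rightarrow> ('k, 'w \<Rightarrow> 'k, 'x, 'y, 'z \<Rightarrow> 'k) trimap" where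
  "tadj f = \<lparr>tdom1 = dual (tcod f), tdom2 = tdom1 f, tdom3 = tdom2 f, tcod = dual (tdom3 f),
     tap = (\<lambda>w' x y z. if z \<in> carr (tdom3 f) then w' (tap f x y z) else 0)\<rparr>"

definition tflip :: "('k, 'x, 'y, 'z, 'w) trimap \<Rightarrow> ('k, 'z, 'y, 'x, 'w) trimap" where
  "tflip f = \<lparr>tdom1 = tdom3 f, tdom2 = tdom2 f, tdom3 = tdom1 f, tcod = tcod f,
     tap = (\<lambda>z y x. tap f x y z)\<rparr>"

abbreviation "badj3 m \<equiv> badj (badj (badj m))"
abbreviation "badj4 m \<equiv> badj (badj3 m)"
abbreviation "tadj4 f \<equiv> tadj (tadj (tadj (tadj f)))"
abbreviation "tadj6 f \<equiv> tadj (tadj (tadj4 f))"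
abbreviation "tadj7 f \<equiv> tadj (tadj6 f)"

definition bvals :: "('k, 'x, 'y, 'z) bimap \<Rightarrow> 'x set \<Rightarrow> 'y set \<Rightarrow> 'z set" where
  "bvals m P Q = {bap m p q | p q. p \<in> P \<and> q \<in> Q}"

definition tvals :: "('k, 'x, 'y, 'z, 'w) trimap \<Rightarrow> 'x set \<Rightarrow> 'y set \<Rightarrow> 'z set \<Rightarrow> 'w set" where
  "tvals f P Q R = {tap f p q r | p q r. p \<in> P \<and> q \<in> Q \<and> r \<in> R}"

definition banach_algebra ::
  "('k::real_normed_field, 'a::ab_group_add) nspace \<Rightarrow> ('k, 'a, 'a, 'a) bimap \<Rightarrow> bool" where
  "banach_algebra A \<pi> \<longleftrightarrow>
     banach_space A \<and> \<pi> \<in> bounded_bilinear_maps A A A \<and>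
     (\<forall>a\<in>carr A. \<forall>b\<in>carr A. \<forall>c\<in>carr A. bap \<pi> (bap \<pi> a b) c = bap \<pi> a (bap \<pi> b c)) \<and>
     (\<forall>a\<in>carr A. \<forall>b\<in>carr A. nrm A (bap \<pi> a b) \<le> nrm A a * nrm A b)"

definition banach_module ::
  "('k::real_normed_field, 'a::ab_group_add) nspace \<Rightarrow> ('k, 'a, 'a, 'a) bimap
     \<Rightarrow> ('k, 'a, 'x, 'x) bimap \<Rightarrow> ('k, 'x::ab_group_add) nspace \<Rightarrow> ('k, 'x, 'a, 'x) bimap
     \<Rightarrow> bool" where
  "banach_module A \<pi> \<pi>1 X \<pi>2 \<longleftrightarrow>
     banach_space X \<and> \<pi>1 \<in> bounded_bilinear_maps A X X \<and> \<pi>2 \<in> bounded_bilinear_maps X A X \<and>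
     (\<forall>a\<in>carr A. \<forall>b\<in>carr A. \<forall>x\<in>carr X.
        bap \<pi>1 (bap \<pi> a b) x = bap \<pi>1 a (bap \<pi>1 b x) \<and>
        bap \<pi>2 x (bap \<pi> a b) = bap \<pi>2 (bap \<pi>2 x a) b \<and>
        bap \<pi>1 a (bap \<pi>2 x b) = bap \<pi>2 (bap \<pi>1 a x) b)"

definition tri_derivation ::
  "('k, 'a) nspace \<Rightarrow> ('k, 'a, 'a, 'a) bimap \<Rightarrow> ('k, 'a, 'x, 'x) bimap \<Rightarrow> ('k, 'x, 'a, 'x) bimap
     \<Rightarrow> ('k, 'a, 'a, 'a, 'x::ab_group_add) trimap \<Rightarrow> bool" where
  "tri_derivation A \<pi> \<pi>1 \<pi>2 D \<longleftrightarrow>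
     (\<forall>a\<in>carr A. \<forall>b\<in>carr A. \<forall>c\<in>carr A. \<forall>d\<in>carr A.
        tap D (bap \<pi> a d) b c = bap \<pi>2 (tap D a b c) d + bap \<pi>1 a (tap D d b c) \<and>
        tap D a (bap \<pi> b d) c = bap \<pi>2 (tap D a b c) d + bap \<pi>1 b (tap D a d c) \<and>
        tap D a b (bap \<pi> c d) = bap \<pi>2 (tap D a b c) d + bap \<pi>1 c (tap D a b d))"

end

theory Submission
  imports Defs
begin

text \<open>
  Call \<open>wlim V F f\<close> the value of \<open>F \<in> V\<^sup>*\<^sup>*\<close> at the bounded linear functional \<open>f\<close>. It is the limit of
  \<open>f\<close> along any net in \<open>V\<close> that converges weak* to \<open>F\<close>, and \<open>D\<^sup>*\<^sup>*\<^sup>*\<^sup>*\<close>, the Arens product and the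
  module actions of \<open>A\<^sup>*\<^sup>*\<close> are iterated limits of this kind. Evaluating both sides of each derivation
  identity at \<open>x' \<in> X\<^sup>*\<close> and expanding \<open>D\<close> on products in \<open>A\<close>, each identity becomes an interchange
  of iterated limits of the two four-linear forms \<open>x' (D(p,q,r) s)\<close> and \<open>x' (p D(q,r,s))\<close>.
  On the other hand, a functional on \<open>A\<^sup>*\<^sup>*\<close> comes from \<open>A\<^sup>*\<close> iff its value at each \<open>F\<close> is
  the limit along \<open>F\<close> of its restriction to \<open>A\<close>, so each of the five conditions is also an
  interchange of limits. Condition (2) matches the first identity and contains (1); conditions (3) and
  (5) concern the same functional; given (1), condition (3) matches the second identity;
  the third identity at \<open>a \<in> A\<close> is (4), and it follows in general from (3) and (4).
\<close>

section \<open>Dual spaces\<close>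

lemma normed_spaceD:
  assumes "normed_space V"
  shows "0 \<in> carr V"
    and "x \<in> carr V \<Longrightarrow> y \<in> carr V \<Longrightarrow> x + y \<in> carr V"
    and "x \<in> carr V \<Longrightarrow> scl V c x \<in> carr V"
    and "x \<in> carr V \<Longrightarrow> y \<in> carr V \<Longrightarrow> nrm V (x + y) \<le> nrm V x + nrm V y"
    and "x \<in> carr V \<Longrightarrow> nrm V (scl V c x) = norm c * nrm V x"
    and "x \<in> carr V \<Longrightarrow> nrm V x = 0 \<longleftrightarrow> x = 0"
    and "x \<in> carr V \<Longrightarrow> nrm V x \<ge> 0"
proof -
  interpret vector_space "scl V"
    using assms by (simp add: normed_space_def)
  have sub: "subspace (carr V)"
    using assms by (simp add: normed_space_def)
  show zero: "0 \<in> carr V"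
    and add: "x \<in> carr V \<Longrightarrow> y \<in> carr V \<Longrightarrow> x + y \<in> carr V"
    and scale: "x \<in> carr V \<Longrightarrow> scl V c x \<in> carr V" for x y c
    using sub by (simp_all add: subspace_def)
  show tri: "x \<in> carr V \<Longrightarrow> y \<in> carr V \<Longrightarrow> nrm V (x + y) \<le> nrm V x + nrm V y"
    and hom: "x \<in> carr V \<Longrightarrow> nrm V (scl V c x) = norm c * nrm V x"
    and def0: "x \<in> carr V \<Longrightarrow> nrm V x = 0 \<longleftrightarrow> x = 0" for x y c
    using assms by (simp_all add: normed_space_def)
  assume x: "x \<in> carr V"
  \<comment> \<open>Nonnegativity of the norm: the triangle inequality for \<open>x\<close> and
    \<open>-x\<close> gives \<open>0 \<le> 2 * nrm V x\<close>.\<close>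
  have "0 = nrm V (x + scl V (-1) x)"
    using def0[OF zero] by simp
  also have "\<dots> \<le> nrm V x + nrm V x"
    using tri[OF x scale[OF x, of "-1"]] hom[OF x, of "-1"] by simp
  finally show "nrm V x \<ge> 0" by simp
qed

lemma scalars_simps [simp]:
  "carr scalars = UNIV" "scl scalars = (*)" "nrm scalars = norm"
  by (simp_all add: scalars_def)

text \<open>Values off \<open>carr V\<close> are left free, unlike for elements of
  \<open>dual V\<close>: the functionals below are lambda terms such as
  \<open>\<lambda>s. x' (bap \<pi>2 u s)\<close>, which nothing forces to vanish there.\<close>

definition bounded_form :: "('k::real_normed_field, 'a::ab_group_add) nspace \<Rightarrow> ('a \<Rightarrow> 'k) \<Rightarrow> bool" where
  "bounded_form V f \<longleftrightarrow> linear_map V scalars f \<and> (\<exists>B. \<forall>x\<in>carr V. norm (f x) \<le> B * nrm V x)"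

lemma mem_dual_iff:
  "f \<in> carr (dual V) \<longleftrightarrow> bounded_form V f \<and> (\<forall>x. x \<notin> carr V \<longrightarrow> f x = 0)"
  by (auto simp: dual_def bounded_form_def)

lemma scl_dual [simp]: "scl (dual V) = (\<lambda>c f x. c * f x)"
  by (simp add: dual_def)

lemma bounded_form_bound_nonneg:
  assumes "normed_space V" "bounded_form V f"
  obtains B where "B \<ge> 0" "\<And>x. x \<in> carr V \<Longrightarrow> norm (f x) \<le> B * nrm V x"
proof -
  obtain B where B: "\<forall>x\<in>carr V. norm (f x) \<le> B * nrm V x"
    using assms(2) by (auto simp: bounded_form_def)
  have "norm (f x) \<le> \<bar>B\<bar> * nrm V x" if "x \<in> carr V" for x
    using B that normed_spaceD(7)[OF assms(1) that] mult_right_mono[of B "\<bar>B\<bar>" "nrm V x"]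
    by fastforce
  then show ?thesis using that[of "\<bar>B\<bar>"] by auto
qed

lemma bounded_form_add:
  assumes V: "normed_space V" and "bounded_form V f" "bounded_form V g"
  shows "bounded_form V (\<lambda>x. f x + g x)"
proof -
  obtain B C where "\<And>x. x \<in> carr V \<Longrightarrow> norm (f x) \<le> B * nrm V x"
    and "\<And>x. x \<in> carr V \<Longrightarrow> norm (g x) \<le> C * nrm V x"
    using assms(2,3) unfolding bounded_form_def by metis
  then have "\<forall>x\<in>carr V. norm (f x + g x) \<le> (B + C) * nrm V x"
    by (metis add_mono distrib_right norm_triangle_le)
  moreover have "linear_map V scalars (\<lambda>x. f x + g x)"
    using assms(2,3) by (auto simp: bounded_form_def linear_map_def algebra_simps)
  ultimately show ?thesis
    unfolding bounded_form_def by blast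
qed

lemma bounded_form_scale:
  assumes "bounded_form V f"
  shows "bounded_form V (\<lambda>x. c * f x)"
proof -
  obtain B where "\<And>x. x \<in> carr V \<Longrightarrow> norm (f x) \<le> B * nrm V x"
    using assms unfolding bounded_form_def by metis
  then have "\<forall>x\<in>carr V. norm (c * f x) \<le> (norm c * B) * nrm V x"
    by (simp add: norm_mult mult.assoc mult_left_mono)
  moreover have "linear_map V scalars (\<lambda>x. c * f x)"
    using assms by (auto simp: bounded_form_def linear_map_def algebra_simps)
  ultimately show ?thesis
    unfolding bounded_form_def by blast
qed

lemma bounded_form_zero: "bounded_form V (\<lambda>x. 0)"
  unfolding bounded_form_def by (auto simp: linear_map_def intro!: exI[of _ 0])

lemma nrm_dual_le:
  assumes V: "normed_space V" and K: "K \<ge> 0" "\<And>x. x \<in> carr V \<Longrightarrow> norm (f x) \<le> K * nrm V x"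
  shows "nrm (dual V) f \<le> K"
proof -
  have "Sup {norm (f x) | x. x \<in> carr V \<and> nrm V x \<le> 1} \<le> K"
  proof (rule cSup_least)
    show "{norm (f x) | x. x \<in> carr V \<and> nrm V x \<le> 1} \<noteq> {}"
      using normed_spaceD(1)[OF V] normed_spaceD(6)[OF V, of 0] by force
  next
    fix t assume "t \<in> {norm (f x) | x. x \<in> carr V \<and> nrm V x \<le> 1}"
    then obtain x where "t = norm (f x)" "x \<in> carr V" "nrm V x \<le> 1" by blast
    then show "t \<le> K"
      using K(2)[of x] mult_left_mono[of "nrm V x" 1 K] K(1) by auto
  qed
  then show ?thesis by (simp add: dual_def)
qed

lemma norm_le_nrm_dual_unit_ball:
  assumes V: "normed_space V" and f: "bounded_form V f"
    and y: "y \<in> carr V" "nrm V y \<le> 1"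
  shows "norm (f y) \<le> nrm (dual V) f"
proof -
  let ?S = "{norm (f x) | x. x \<in> carr V \<and> nrm V x \<le> 1}"
  obtain B where B: "B \<ge> 0" "\<And>x. x \<in> carr V \<Longrightarrow> norm (f x) \<le> B * nrm V x"
    using bounded_form_bound_nonneg[OF V f] by blast
  have "bdd_above ?S"
  proof (rule bdd_aboveI)
    fix t assume "t \<in> ?S"
    then obtain x where "t = norm (f x)" "x \<in> carr V" "nrm V x \<le> 1" by blast
    then show "t \<le> B"
      using B(2)[of x] mult_left_mono[of "nrm V x" 1 B] B(1) by auto
  qed
  then show ?thesis
    using y by (auto simp: dual_def intro!: cSup_upper)
qed

text \<open>The dual norm is a supremum over the unit ball, so a vector of nonzero norm is first
  normalised by a real scalar embedded with \<open>of_real\<close>; at norm 0 the boundedness of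
  \<open>f\<close> forces the value 0.\<close>

lemma norm_le_nrm_dual:
  assumes V: "normed_space V" and f: "bounded_form V f" and x: "x \<in> carr V"
  shows "norm (f x) \<le> nrm (dual V) f * nrm V x"
proof (cases "nrm V x = 0")
  case True
  moreover obtain B where "norm (f x) \<le> B * nrm V x"
    using f x by (auto simp: bounded_form_def)
  ultimately show ?thesis by simp
next
  case False
  define c :: 'a where "c = of_real (inverse (nrm V x))"
  have pos: "nrm V x > 0"
    using False normed_spaceD(7)[OF V x] by simp
  then have c: "norm c = inverse (nrm V x)"
    by (simp add: c_def norm_inverse)
  have "nrm V (scl V c x) \<le> 1"
    using normed_spaceD(5)[OF V x, of c] c pos by simp
  then have "norm (f (scl V c x)) \<le> nrm (dual V) f"
    using norm_le_nrm_dual_unit_ball[OF V f] normed_spaceD(3)[OF V x] by blast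
  moreover have "f (scl V c x) = c * f x"
    using f x by (simp add: bounded_form_def linear_map_def)
  ultimately have "inverse (nrm V x) * norm (f x) \<le> nrm (dual V) f"
    by (simp add: norm_mult c)
  then show ?thesis using pos by (simp add: field_simps)
qed

lemma nrm_dual_nonneg:
  assumes V: "normed_space V" and f: "bounded_form V f"
  shows "nrm (dual V) f \<ge> 0"
  using norm_le_nrm_dual_unit_ball[OF V f, of 0] normed_spaceD(1)[OF V] normed_spaceD(6)[OF V, of 0]
  by (auto intro: order_trans[OF norm_ge_zero])

lemma normed_space_dual:
  assumes V: "normed_space V"
  shows "normed_space (dual V)"
  unfolding normed_space_def
proof (intro conjI ballI allI)
  show vs: "vector_space (scl (dual V))"
    by unfold_locales (auto simp: algebra_simps)
  interpret vector_space "scl (dual V)" by (rule vs)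
  show "subspace (carr (dual V))"
    unfolding subspace_def
    using bounded_form_add[OF V] bounded_form_scale bounded_form_zero
    by (auto simp: mem_dual_iff zero_fun_def plus_fun_def)
next
  fix f assume "f \<in> carr (dual V)"
  then have f: "bounded_form V f" "\<And>x. x \<notin> carr V \<Longrightarrow> f x = 0"
    by (auto simp: mem_dual_iff)
  show "nrm (dual V) f = 0 \<longleftrightarrow> f = 0"
  proof
    assume "nrm (dual V) f = 0"
    then show "f = 0"
      using norm_le_nrm_dual[OF V f(1)] f(2) by (fastforce simp: zero_fun_def)
  next
    assume "f = 0"
    then show "nrm (dual V) f = 0"
      using nrm_dual_le[OF V, of 0 f] nrm_dual_nonneg[OF V f(1)] by simp
  qed
next
  fix f g assume "f \<in> carr (dual V)" "g \<in> carr (dual V)"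
  then have f: "bounded_form V f" and g: "bounded_form V g"
    by (auto simp: mem_dual_iff)
  show "nrm (dual V) (f + g) \<le> nrm (dual V) f + nrm (dual V) g"
  proof (rule nrm_dual_le[OF V])
    show "0 \<le> nrm (dual V) f + nrm (dual V) g"
      using nrm_dual_nonneg[OF V] f g by simp
    show "norm ((f + g) x) \<le> (nrm (dual V) f + nrm (dual V) g) * nrm V x"
      if "x \<in> carr V" for x
      using norm_le_nrm_dual[OF V f that] norm_le_nrm_dual[OF V g that]
        norm_triangle_ineq[of "f x" "g x"] by (simp add: distrib_right)
  qed
next
  fix c f assume "f \<in> carr (dual V)"
  then have f: "bounded_form V f"
    by (auto simp: mem_dual_iff)
  \<comment> \<open>For nonzero \<open>c\<close>, this inequality for \<open>c\<close> and for
    \<open>inverse c\<close> acting on \<open>c * f\<close> gives the two halves of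
    homogeneity.\<close>
  have le: "nrm (dual V) (\<lambda>x. c * g x) \<le> norm c * nrm (dual V) g" if g: "bounded_form V g" for c g
    by (rule nrm_dual_le[OF V])
      (auto simp: norm_mult mult.assoc nrm_dual_nonneg[OF V g] norm_le_nrm_dual[OF V g]
        intro!: mult_left_mono)
  show "nrm (dual V) (scl (dual V) c f) = norm c * nrm (dual V) f"
  proof (cases "c = 0")
    case True
    then show ?thesis
      using le[OF f, of 0] nrm_dual_nonneg[OF V bounded_form_zero] by simp
  next
    case False
    have "nrm (dual V) f \<le> norm (inverse c) * nrm (dual V) (\<lambda>x. c * f x)"
      using le[OF bounded_form_scale[OF f, of c], of "inverse c"] False
      by (simp add: mult.assoc[symmetric])
    then have "norm c * nrm (dual V) f \<le> nrm (dual V) (\<lambda>x. c * f x)"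
      using False by (simp add: norm_divide field_simps)
    then show ?thesis
      using le[OF f, of c] by simp
  qed
qed


text \<open>Equality in a dual space is equality of functions on the whole type, so a functional is
  cut off to 0 outside the carrier to become the element of \<open>dual V\<close> that it
  represents.\<close>

definition zext :: "('k::real_normed_field, 'a::ab_group_add) nspace \<Rightarrow> ('a \<Rightarrow> 'k) \<Rightarrow> 'a \<Rightarrow> 'k" where
  "zext V f = (\<lambda>x. if x \<in> carr V then f x else 0)"

lemma zext_cong: "(\<And>x. x \<in> carr V \<Longrightarrow> f x = g x) \<Longrightarrow> zext V f = zext V g"
  by (auto simp: zext_def)

lemma zext_apply [simp]: "x \<in> carr V \<Longrightarrow> zext V f x = f x"
  by (simp add: zext_def)

lemma zext_mem_dual:
  assumes "normed_space V" "bounded_form V f"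
  shows "zext V f \<in> carr (dual V)"
  using assms(2) normed_spaceD(2,3)[OF assms(1)]
  by (auto simp: mem_dual_iff bounded_form_def linear_map_def zext_def)

lemma zext_mem_dualI:
  assumes V: "normed_space V" and "linear_map V scalars f"
    and "\<And>x. x \<in> carr V \<Longrightarrow> norm (f x) \<le> K * nrm V x"
  shows "zext V f \<in> carr (dual V)"
  using assms by (intro zext_mem_dual) (auto simp: bounded_form_def)

lemma zext_dual [simp]: "f \<in> carr (dual V) \<Longrightarrow> zext V f = f"
  by (auto simp: zext_def mem_dual_iff)

lemma nrm_zext_le:
  assumes "normed_space V" "K \<ge> 0" "\<And>x. x \<in> carr V \<Longrightarrow> norm (f x) \<le> K * nrm V x"
  shows "nrm (dual V) (zext V f) \<le> K"
  using assms by (intro nrm_dual_le) auto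

lemma dual_eq_iff:
  assumes "f \<in> carr (dual V)" "g \<in> carr (dual V)"
  shows "f = g \<longleftrightarrow> (\<forall>x\<in>carr V. f x = g x)"
  using assms by (fastforce simp: mem_dual_iff)

lemma dualD:
  assumes "f \<in> carr (dual V)"
  shows "linear_map V scalars f" "bounded_form V f"
    and "x \<in> carr V \<Longrightarrow> y \<in> carr V \<Longrightarrow> f (x + y) = f x + f y"
    and "x \<in> carr V \<Longrightarrow> f (scl V c x) = c * f x"
  using assms by (auto simp: mem_dual_iff bounded_form_def linear_map_def)

lemma linear_map_comp:
  "linear_map U V f \<Longrightarrow> linear_map V W g \<Longrightarrow> linear_map U W (\<lambda>x. g (f x))"
  by (auto simp: linear_map_def)

section \<open>Adjoints of bounded multilinear maps\<close>

lemma bounded_bilinear_maps_bound: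
  assumes "normed_space X" "normed_space Y" "m \<in> bounded_bilinear_maps X Y Z"
  obtains B where "B \<ge> 0"
    "\<And>x y. x \<in> carr X \<Longrightarrow> y \<in> carr Y \<Longrightarrow> nrm Z (bap m x y) \<le> B * nrm X x * nrm Y y"
proof -
  obtain B where B: "\<forall>x\<in>carr X. \<forall>y\<in>carr Y. nrm Z (bap m x y) \<le> B * nrm X x * nrm Y y"
    using assms(3) unfolding bounded_bilinear_maps_def by blast
  have "nrm Z (bap m x y) \<le> \<bar>B\<bar> * nrm X x * nrm Y y" if "x \<in> carr X" "y \<in> carr Y" for x y
    by (rule order_trans[OF B[rule_format, OF that]])
      (intro mult_right_mono normed_spaceD(7) assms that abs_ge_self)
  then show ?thesis using that[of "\<bar>B\<bar>"] by auto
qed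

lemma bounded_trilinear_maps_bound:
  assumes "normed_space X" "normed_space Y" "normed_space Z" "f \<in> bounded_trilinear_maps X Y Z W"
  obtains B where "B \<ge> 0"
    "\<And>x y z. x \<in> carr X \<Longrightarrow> y \<in> carr Y \<Longrightarrow> z \<in> carr Z \<Longrightarrow>
       nrm W (tap f x y z) \<le> B * nrm X x * nrm Y y * nrm Z z"
proof -
  obtain B where B: "\<forall>x\<in>carr X. \<forall>y\<in>carr Y. \<forall>z\<in>carr Z.
      nrm W (tap f x y z) \<le> B * nrm X x * nrm Y y * nrm Z z"
    using assms(4) unfolding bounded_trilinear_maps_def by blast
  have "nrm W (tap f x y z) \<le> \<bar>B\<bar> * nrm X x * nrm Y y * nrm Z z"
    if "x \<in> carr X" "y \<in> carr Y" "z \<in> carr Z" for x y z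
    by (rule order_trans[OF B[rule_format, OF that]])
      (intro mult_right_mono normed_spaceD(7) assms that abs_ge_self)
  then show ?thesis using that[of "\<bar>B\<bar>"] by auto
qed

lemma bounded_bilinear_mapsD:
  assumes "m \<in> bounded_bilinear_maps X Y Z"
  shows "bdom1 m = X" "bdom2 m = Y" "bcod m = Z"
    and "y \<in> carr Y \<Longrightarrow> linear_map X Z (\<lambda>x. bap m x y)"
    and "x \<in> carr X \<Longrightarrow> linear_map Y Z (bap m x)"
    and "x \<in> carr X \<Longrightarrow> y \<in> carr Y \<Longrightarrow> bap m x y \<in> carr Z"
  using assms by (auto simp: bounded_bilinear_maps_def linear_map_def)

lemma bounded_trilinear_mapsD:
  assumes "f \<in> bounded_trilinear_maps X Y Z W"
  shows "tdom1 f = X" "tdom2 f = Y" "tdom3 f = Z" "tcod f = W"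
    and "y \<in> carr Y \<Longrightarrow> z \<in> carr Z \<Longrightarrow> linear_map X W (\<lambda>x. tap f x y z)"
    and "x \<in> carr X \<Longrightarrow> z \<in> carr Z \<Longrightarrow> linear_map Y W (\<lambda>y. tap f x y z)"
    and "x \<in> carr X \<Longrightarrow> y \<in> carr Y \<Longrightarrow> linear_map Z W (tap f x y)"
    and "x \<in> carr X \<Longrightarrow> y \<in> carr Y \<Longrightarrow> z \<in> carr Z \<Longrightarrow> tap f x y z \<in> carr W"
  using assms by (auto simp: bounded_trilinear_maps_def linear_map_def)

text \<open>Adjoints are rewritten with \<open>zext\<close> without any carrier assumption, so that
  the facts on \<open>zext\<close> replace the case distinctions in their definitions.\<close>

lemma bap_badj: "bap (badj m) z' x = zext (bdom2 m) (\<lambda>y. z' (bap m x y))"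
  by (simp add: badj_def zext_def)

lemma tap_tadj: "tap (tadj f) w' x y = zext (tdom3 f) (\<lambda>z. w' (tap f x y z))"
  by (simp add: tadj_def zext_def)

lemma dom_cod_badj [simp]:
  "bdom1 (badj m) = dual (bcod m)" "bdom2 (badj m) = bdom1 m" "bcod (badj m) = dual (bdom2 m)"
  by (simp_all add: badj_def)

lemma dom_cod_tadj [simp]:
  "tdom1 (tadj f) = dual (tcod f)" "tdom2 (tadj f) = tdom1 f" "tdom3 (tadj f) = tdom2 f"
  "tcod (tadj f) = dual (tdom3 f)"
  by (simp_all add: tadj_def)

lemma linear_map_zext:
  assumes "\<And>y. y \<in> carr V \<Longrightarrow> linear_map U scalars (\<lambda>x. f x y)"
    and "\<And>x. x \<in> carr U \<Longrightarrow> zext V (f x) \<in> carr (dual V)"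
  shows "linear_map U (dual V) (\<lambda>x. zext V (f x))"
  using assms by (auto simp: linear_map_def zext_def fun_eq_iff)

text \<open>The estimate \<open>norm (z' (bap m x y)) \<le> nrm (dual Z) z' * nrm Z (bap m x
  y)\<close> shows that the adjoint inherits the constant \<open>B\<close>. Iteration keeps all
  values of higher adjoints in the carriers of the dual spaces.\<close>

lemma badj_bounded:
  assumes X: "normed_space X" and Y: "normed_space Y" and Z: "normed_space Z"
    and m: "m \<in> bounded_bilinear_maps X Y Z"
  shows "badj m \<in> bounded_bilinear_maps (dual Z) X (dual Y)"
proof -
  note mD = bounded_bilinear_mapsD[OF m]
  obtain B where B: "B \<ge> 0"
    "\<And>x y. x \<in> carr X \<Longrightarrow> y \<in> carr Y \<Longrightarrow> nrm Z (bap m x y) \<le> B * nrm X x * nrm Y y"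
    using bounded_bilinear_maps_bound[OF X Y m] by blast
  have bound: "norm (z' (bap m x y)) \<le> (B * nrm (dual Z) z' * nrm X x) * nrm Y y"
    and nonneg: "B * nrm (dual Z) z' * nrm X x \<ge> 0"
    if "z' \<in> carr (dual Z)" "x \<in> carr X" "y \<in> carr Y" for z' x y
  proof -
    have z': "nrm (dual Z) z' \<ge> 0"
      using nrm_dual_nonneg[OF Z] dualD that by blast
    have "norm (z' (bap m x y)) \<le> nrm (dual Z) z' * nrm Z (bap m x y)"
      using norm_le_nrm_dual[OF Z] dualD that mD by blast
    also have "\<dots> \<le> nrm (dual Z) z' * (B * nrm X x * nrm Y y)"
      using B(2) that z' by (intro mult_left_mono) auto
    finally show "norm (z' (bap m x y)) \<le> (B * nrm (dual Z) z' * nrm X x) * nrm Y y"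
      by (simp add: algebra_simps)
    show "B * nrm (dual Z) z' * nrm X x \<ge> 0"
      using B(1) z' normed_spaceD(7)[OF X] that by simp
  qed
  have mem: "zext Y (\<lambda>y. z' (bap m x y)) \<in> carr (dual Y)"
    if "z' \<in> carr (dual Z)" "x \<in> carr X" for z' x
    using bound[OF that] linear_map_comp[OF mD(5) dualD(1)] that
    by (intro zext_mem_dualI[OF Y]) auto
  \<comment> \<open>The fact \<open>nonneg\<close> shares the assumptions of \<open>bound\<close>;
    the vector 0 of \<open>Y\<close> only fills the slot of \<open>y\<close>.\<close>
  have "nrm (dual Y) (zext Y (\<lambda>y. z' (bap m x y))) \<le> B * nrm (dual Z) z' * nrm X x"
    if "z' \<in> carr (dual Z)" "x \<in> carr X" for z' x
    using bound[OF that] nonneg[OF that normed_spaceD(1)[OF Y]] by (intro nrm_zext_le[OF Y])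
  moreover have "linear_map (dual Z) (dual Y) (\<lambda>z'. zext Y (\<lambda>y. z' (bap m x y)))"
    if "x \<in> carr X" for x
    using mem that by (intro linear_map_zext) (auto simp: linear_map_def)
  moreover have "linear_map X (dual Y) (\<lambda>x. zext Y (\<lambda>y. z' (bap m x y)))"
    if "z' \<in> carr (dual Z)" for z'
    using mem that linear_map_comp[OF mD(4) dualD(1)] by (intro linear_map_zext) auto
  ultimately show ?thesis
    unfolding bounded_bilinear_maps_def by (auto simp: bap_badj[abs_def] mD)
qed

lemma tadj_bounded:
  assumes X: "normed_space X" and Y: "normed_space Y" and Z: "normed_space Z"
    and W: "normed_space W" and f: "f \<in> bounded_trilinear_maps X Y Z W"
  shows "tadj f \<in> bounded_trilinear_maps (dual W) X Y (dual Z)"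
proof -
  note fD = bounded_trilinear_mapsD[OF f]
  obtain B where B: "B \<ge> 0"
    "\<And>x y z. x \<in> carr X \<Longrightarrow> y \<in> carr Y \<Longrightarrow> z \<in> carr Z \<Longrightarrow>
       nrm W (tap f x y z) \<le> B * nrm X x * nrm Y y * nrm Z z"
    using bounded_trilinear_maps_bound[OF X Y Z f] by blast
  have bound: "norm (w' (tap f x y z)) \<le> (B * nrm (dual W) w' * nrm X x * nrm Y y) * nrm Z z"
    and nonneg: "B * nrm (dual W) w' * nrm X x * nrm Y y \<ge> 0"
    if "w' \<in> carr (dual W)" "x \<in> carr X" "y \<in> carr Y" "z \<in> carr Z" for w' x y z
  proof -
    have w': "nrm (dual W) w' \<ge> 0"
      using nrm_dual_nonneg[OF W] dualD that by blast
    have "norm (w' (tap f x y z)) \<le> nrm (dual W) w' * nrm W (tap f x y z)"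
      using norm_le_nrm_dual[OF W] dualD that fD by blast
    also have "\<dots> \<le> nrm (dual W) w' * (B * nrm X x * nrm Y y * nrm Z z)"
      using B(2) that w' by (intro mult_left_mono) auto
    finally show "norm (w' (tap f x y z)) \<le> (B * nrm (dual W) w' * nrm X x * nrm Y y) * nrm Z z"
      by (simp add: algebra_simps)
    show "B * nrm (dual W) w' * nrm X x * nrm Y y \<ge> 0"
      using B(1) w' normed_spaceD(7)[OF X] normed_spaceD(7)[OF Y] that by simp
  qed
  have mem: "zext Z (\<lambda>z. w' (tap f x y z)) \<in> carr (dual Z)"
    if "w' \<in> carr (dual W)" "x \<in> carr X" "y \<in> carr Y" for w' x y
    using bound[OF that] linear_map_comp[OF fD(7) dualD(1)] that
    by (intro zext_mem_dualI[OF Z]) auto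
  have "nrm (dual Z) (zext Z (\<lambda>z. w' (tap f x y z))) \<le> B * nrm (dual W) w' * nrm X x * nrm Y y"
    if "w' \<in> carr (dual W)" "x \<in> carr X" "y \<in> carr Y" for w' x y
    using bound[OF that] nonneg[OF that normed_spaceD(1)[OF Z]] by (intro nrm_zext_le[OF Z])
  moreover have "linear_map (dual W) (dual Z) (\<lambda>w'. zext Z (\<lambda>z. w' (tap f x y z)))"
    if "x \<in> carr X" "y \<in> carr Y" for x y
    using mem that by (intro linear_map_zext) (auto simp: linear_map_def)
  moreover have "linear_map X (dual Z) (\<lambda>x. zext Z (\<lambda>z. w' (tap f x y z)))"
    if "w' \<in> carr (dual W)" "y \<in> carr Y" for w' y
    using mem that linear_map_comp[OF fD(5) dualD(1)] by (intro linear_map_zext) auto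
  moreover have "linear_map Y (dual Z) (\<lambda>y. zext Z (\<lambda>z. w' (tap f x y z)))"
    if "w' \<in> carr (dual W)" "x \<in> carr X" for w' x
    using mem that linear_map_comp[OF fD(6) dualD(1)] by (intro linear_map_zext) auto
  ultimately show ?thesis
    unfolding bounded_trilinear_maps_def by (auto simp: tap_tadj[abs_def] fD)
qed

section \<open>Weak* limits of multilinear forms\<close>

definition wlim :: "('k::real_normed_field, 'a::ab_group_add) nspace \<Rightarrow> (('a \<Rightarrow> 'k) \<Rightarrow> 'k)
    \<Rightarrow> ('a \<Rightarrow> 'k) \<Rightarrow> 'k" where
  "wlim V F f = F (zext V f)"

lemma wlim_cong: "(\<And>x. x \<in> carr V \<Longrightarrow> f x = g x) \<Longrightarrow> wlim V F f = wlim V F g"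
  unfolding wlim_def by (metis zext_cong)

text \<open>Evaluation at \<open>x\<close> is bounded with constant \<open>nrm V x\<close>.\<close>

lemma emb_mem:
  assumes V: "normed_space V" and x: "x \<in> carr V"
  shows "emb V x \<in> carr (bidual V)"
proof -
  have "zext (dual V) (\<lambda>f. f x) \<in> carr (bidual V)"
    using norm_le_nrm_dual[OF V dualD(2) x]
    by (intro zext_mem_dualI[where K = "nrm V x"] normed_space_dual V)
      (auto simp: linear_map_def mult.commute)
  then show ?thesis by (simp add: emb_def zext_def)
qed

lemma emb_apply [simp]: "f \<in> carr (dual V) \<Longrightarrow> emb V x f = f x"
  by (simp add: emb_def)

text \<open>\<open>emb V x\<close> is the weak* limit of the net constant at
  \<open>x\<close>.\<close>

lemma wlim_emb:
  assumes "normed_space V" "x \<in> carr V" "bounded_form V f"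
  shows "wlim V (emb V x) f = f x"
  using assms zext_mem_dual[OF assms(1,3)] by (simp add: wlim_def)

lemma wlim_add:
  assumes V: "normed_space V" and F: "F \<in> carr (bidual V)"
    and f: "bounded_form V f" and g: "bounded_form V g"
  shows "wlim V F (\<lambda>x. f x + g x) = wlim V F f + wlim V F g"
proof -
  have "zext V (\<lambda>x. f x + g x) = zext V f + zext V g"
    by (auto simp: zext_def)
  then show ?thesis
    using dualD(3)[OF F] zext_mem_dual[OF V] f g by (simp add: wlim_def)
qed

lemma wlim_scale:
  assumes V: "normed_space V" and F: "F \<in> carr (bidual V)" and f: "bounded_form V f"
  shows "wlim V F (\<lambda>x. c * f x) = c * wlim V F f"
proof -
  have "zext V (\<lambda>x. c * f x) = scl (dual V) c (zext V f)"
    by (auto simp: zext_def)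
  then show ?thesis
    using dualD(4)[OF F] zext_mem_dual[OF V f] by (simp add: wlim_def)
qed

lemma norm_wlim_le:
  assumes V: "normed_space V" and F: "F \<in> carr (bidual V)" and f: "bounded_form V f"
    and K: "K \<ge> 0" "\<And>x. x \<in> carr V \<Longrightarrow> norm (f x) \<le> K * nrm V x"
  shows "norm (wlim V F f) \<le> nrm (bidual V) F * K"
proof -
  have "norm (wlim V F f) \<le> nrm (bidual V) F * nrm (dual V) (zext V f)"
    unfolding wlim_def
    using norm_le_nrm_dual[OF normed_space_dual[OF V] dualD(2)[OF F]] zext_mem_dual[OF V f] by blast
  also have "\<dots> \<le> nrm (bidual V) F * K"
    using nrm_zext_le[OF V] K nrm_dual_nonneg[OF normed_space_dual[OF V] dualD(2)[OF F]]
    by (intro mult_left_mono) auto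
  finally show ?thesis .
qed

text \<open>\<open>wlim\<close> is linear in the functional, hence linearity in the parameter
  \<open>p\<close> survives the limit in \<open>s\<close>.\<close>

lemma linear_map_wlim:
  assumes V: "normed_space V" and F: "F \<in> carr (bidual V)"
    and "\<And>s. s \<in> carr V \<Longrightarrow> linear_map U scalars (\<lambda>p. f p s)"
    and "\<And>p. p \<in> carr U \<Longrightarrow> bounded_form V (f p)"
  shows "linear_map U scalars (\<lambda>p. wlim V F (f p))"
  unfolding linear_map_def
proof (intro conjI ballI allI)
  fix p q assume pq: "p \<in> carr U" "q \<in> carr U"
  have "wlim V F (f (p + q)) = wlim V F (\<lambda>s. f p s + f q s)"
    using assms(3) pq by (intro wlim_cong) (auto simp: linear_map_def)
  then show "wlim V F (f (p + q)) = wlim V F (f p) + wlim V F (f q)"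
    using wlim_add[OF V F] assms(4) pq by simp
next
  fix c p assume p: "p \<in> carr U"
  have "wlim V F (f (scl U c p)) = wlim V F (\<lambda>s. c * f p s)"
    using assms(3) p by (intro wlim_cong) (auto simp: linear_map_def)
  then show "wlim V F (f (scl U c p)) = scl scalars c (wlim V F (f p))"
    using wlim_scale[OF V F] assms(4) p by simp
qed simp

section \<open>Bounded multilinear forms and limits in their last variable\<close>

definition form2 where
  "form2 V f \<longleftrightarrow> (\<forall>y\<in>carr V. linear_map V scalars (\<lambda>x. f x y)) \<and>
     (\<forall>x\<in>carr V. linear_map V scalars (f x)) \<and>
     (\<exists>B\<ge>0. \<forall>x\<in>carr V. \<forall>y\<in>carr V. norm (f x y) \<le> B * nrm V x * nrm V y)"

definition form3 where
  "form3 V f \<longleftrightarrow> (\<forall>y\<in>carr V. \<forall>z\<in>carr V. linear_map V scalars (\<lambda>x. f x y z)) \<and>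
     (\<forall>x\<in>carr V. \<forall>z\<in>carr V. linear_map V scalars (\<lambda>y. f x y z)) \<and>
     (\<forall>x\<in>carr V. \<forall>y\<in>carr V. linear_map V scalars (f x y)) \<and>
     (\<exists>B\<ge>0. \<forall>x\<in>carr V. \<forall>y\<in>carr V. \<forall>z\<in>carr V.
        norm (f x y z) \<le> B * nrm V x * nrm V y * nrm V z)"

definition form4 where
  "form4 V f \<longleftrightarrow>
     (\<forall>y\<in>carr V. \<forall>z\<in>carr V. \<forall>w\<in>carr V. linear_map V scalars (\<lambda>x. f x y z w)) \<and>
     (\<forall>x\<in>carr V. \<forall>z\<in>carr V. \<forall>w\<in>carr V. linear_map V scalars (\<lambda>y. f x y z w)) \<and>
     (\<forall>x\<in>carr V. \<forall>y\<in>carr V. \<forall>w\<in>carr V. linear_map V scalars (\<lambda>z. f x y z w)) \<and>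
     (\<forall>x\<in>carr V. \<forall>y\<in>carr V. \<forall>z\<in>carr V. linear_map V scalars (f x y z)) \<and>
     (\<exists>B\<ge>0. \<forall>x\<in>carr V. \<forall>y\<in>carr V. \<forall>z\<in>carr V. \<forall>w\<in>carr V.
        norm (f x y z w) \<le> B * nrm V x * nrm V y * nrm V z * nrm V w)"

lemma form2_apply:
  assumes "form2 V f" "x \<in> carr V"
  shows "bounded_form V (f x)"
  using assms unfolding form2_def bounded_form_def by blast

text \<open>Fixing the first variable at \<open>x\<close> turns the bound \<open>B\<close> into
  \<open>B * nrm V x\<close>. The sign of the bound is tracked because the estimate
  \<open>norm_wlim_le\<close> asks for a nonnegative constant.\<close>

lemma form3_apply:
  assumes V: "normed_space V" and f: "form3 V f" and x: "x \<in> carr V"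
  shows "form2 V (f x)"
proof -
  obtain B where "B \<ge> 0" and B: "\<forall>x\<in>carr V. \<forall>y\<in>carr V. \<forall>z\<in>carr V.
      norm (f x y z) \<le> B * nrm V x * nrm V y * nrm V z"
    using f unfolding form3_def by blast
  then have "B * nrm V x \<ge> 0"
    using normed_spaceD(7)[OF V x] by simp
  then have "\<exists>B\<ge>0. \<forall>y\<in>carr V. \<forall>z\<in>carr V. norm (f x y z) \<le> B * nrm V y * nrm V z"
    using B x by blast
  then show ?thesis
    using f x unfolding form3_def form2_def by blast
qed

lemma form4_apply:
  assumes V: "normed_space V" and f: "form4 V f" and x: "x \<in> carr V"
  shows "form3 V (f x)"
proof -
  obtain B where "B \<ge> 0" and B: "\<forall>x\<in>carr V. \<forall>y\<in>carr V. \<forall>z\<in>carr V. \<forall>w\<in>carr V.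
      norm (f x y z w) \<le> B * nrm V x * nrm V y * nrm V z * nrm V w"
    using f unfolding form4_def by blast
  then have "B * nrm V x \<ge> 0"
    using normed_spaceD(7)[OF V x] by simp
  then have "\<exists>B\<ge>0. \<forall>y\<in>carr V. \<forall>z\<in>carr V. \<forall>w\<in>carr V.
      norm (f x y z w) \<le> B * nrm V y * nrm V z * nrm V w"
    using B x by blast
  then show ?thesis
    using f x unfolding form4_def form3_def by blast
qed

text \<open>By \<open>norm_wlim_le\<close> the limit costs a factor \<open>nrm (bidual V) F\<close>
  in the bound. Here and in the next two lemmas a limit removes the last variable, so that every
  stage of an iterated limit is taken of a bounded form.\<close>

lemma form2_wlim:
  assumes V: "normed_space V" and F: "F \<in> carr (bidual V)" and f: "form2 V f"
  shows "bounded_form V (\<lambda>x. wlim V F (f x))"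
proof -
  obtain B where "B \<ge> 0" and B: "\<forall>x\<in>carr V. \<forall>y\<in>carr V. norm (f x y) \<le> B * nrm V x * nrm V y"
    using f unfolding form2_def by blast
  have "norm (wlim V F (f x)) \<le> nrm (bidual V) F * B * nrm V x" if x: "x \<in> carr V" for x
    using norm_wlim_le[OF V F form2_apply[OF f x], of "B * nrm V x"] B \<open>B \<ge> 0\<close> x
      normed_spaceD(7)[OF V x] by (simp add: mult.assoc)
  moreover have "linear_map V scalars (\<lambda>x. wlim V F (f x))"
    using f form2_apply[OF f] by (intro linear_map_wlim[OF V F]) (auto simp: form2_def)
  ultimately show ?thesis
    unfolding bounded_form_def by blast
qed

lemma form3_wlim:
  assumes V: "normed_space V" and F: "F \<in> carr (bidual V)" and f: "form3 V f"
  shows "form2 V (\<lambda>x y. wlim V F (f x y))"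
proof -
  note app = form2_apply[OF form3_apply[OF V f]]
  obtain B where "B \<ge> 0" and B: "\<forall>x\<in>carr V. \<forall>y\<in>carr V. \<forall>z\<in>carr V.
      norm (f x y z) \<le> B * nrm V x * nrm V y * nrm V z"
    using f unfolding form3_def by blast
  have "norm (wlim V F (f x y)) \<le> nrm (bidual V) F * B * nrm V x * nrm V y"
    if "x \<in> carr V" "y \<in> carr V" for x y
    using norm_wlim_le[OF V F app[OF that], of "B * nrm V x * nrm V y"] B \<open>B \<ge> 0\<close> that
      normed_spaceD(7)[OF V] by (simp add: mult.assoc)
  moreover have "nrm (bidual V) F * B \<ge> 0"
    using \<open>B \<ge> 0\<close> nrm_dual_nonneg[OF normed_space_dual[OF V] dualD(2)[OF F]] by simp
  moreover have "linear_map V scalars (\<lambda>x. wlim V F (f x y))" if "y \<in> carr V" for y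
    using f app that by (intro linear_map_wlim[OF V F]) (auto simp: form3_def)
  moreover have "linear_map V scalars (\<lambda>y. wlim V F (f x y))" if "x \<in> carr V" for x
    using f app that by (intro linear_map_wlim[OF V F]) (auto simp: form3_def)
  ultimately show ?thesis
    unfolding form2_def by blast
qed

lemma form4_wlim:
  assumes V: "normed_space V" and F: "F \<in> carr (bidual V)" and f: "form4 V f"
  shows "form3 V (\<lambda>x y z. wlim V F (f x y z))"
proof -
  note app = form2_apply[OF form3_apply[OF V form4_apply[OF V f]]]
  obtain B where "B \<ge> 0" and B: "\<forall>x\<in>carr V. \<forall>y\<in>carr V. \<forall>z\<in>carr V. \<forall>w\<in>carr V.
      norm (f x y z w) \<le> B * nrm V x * nrm V y * nrm V z * nrm V w"
    using f unfolding form4_def by blast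
  have "norm (wlim V F (f x y z)) \<le> nrm (bidual V) F * B * nrm V x * nrm V y * nrm V z"
    if "x \<in> carr V" "y \<in> carr V" "z \<in> carr V" for x y z
    using norm_wlim_le[OF V F app[OF that], of "B * nrm V x * nrm V y * nrm V z"] B \<open>B \<ge> 0\<close> that
      normed_spaceD(7)[OF V] by (simp add: mult.assoc)
  moreover have "nrm (bidual V) F * B \<ge> 0"
    using \<open>B \<ge> 0\<close> nrm_dual_nonneg[OF normed_space_dual[OF V] dualD(2)[OF F]] by simp
  moreover have "linear_map V scalars (\<lambda>x. wlim V F (f x y z))" if "y \<in> carr V" "z \<in> carr V" for y z
    using f app that by (intro linear_map_wlim[OF V F]) (auto simp: form4_def)
  moreover have "linear_map V scalars (\<lambda>y. wlim V F (f x y z))" if "x \<in> carr V" "z \<in> carr V" for x z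
    using f app that by (intro linear_map_wlim[OF V F]) (auto simp: form4_def)
  moreover have "linear_map V scalars (\<lambda>z. wlim V F (f x y z))" if "x \<in> carr V" "y \<in> carr V" for x y
    using f app that by (intro linear_map_wlim[OF V F]) (auto simp: form4_def)
  ultimately show ?thesis
    unfolding form3_def by blast
qed

text \<open>An element \<open>emb (dual V) h\<close> of the canonical image takes the value
  \<open>h s\<close> at \<open>emb V s\<close>, so \<open>h\<close> is recovered from the values on
  \<open>V\<close>. If \<open>G\<close> comes from \<open>dual V\<close> at all, it therefore comes
  from \<open>zext V g\<close>, and its value at \<open>F\<close> is \<open>F (zext V g)\<close>.
  This turns each inclusion in \<open>canon (dual A)\<close> into an equation of limits.\<close>

lemma zext_mem_canon_dual_iff:
  assumes V: "normed_space V" and g: "bounded_form V g"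
    and G: "\<And>s. s \<in> carr V \<Longrightarrow> G (emb V s) = g s"
  shows "zext (bidual V) G \<in> canon (dual V) \<longleftrightarrow> (\<forall>F\<in>carr (bidual V). G F = wlim V F g)"
proof
  assume "zext (bidual V) G \<in> canon (dual V)"
  then obtain h where h: "h \<in> carr (dual V)" "zext (bidual V) G = emb (dual V) h"
    by (auto simp: canon_def)
  have eq: "G F = F h" if "F \<in> carr (bidual V)" for F
    using fun_cong[OF h(2), of F] that by simp
  have "g s = h s" if "s \<in> carr V" for s
    using eq[OF emb_mem[OF V that]] G[OF that] h(1) by simp
  then have "zext V g = zext V h"
    by (rule zext_cong)
  then show "\<forall>F\<in>carr (bidual V). G F = wlim V F g"
    using eq h(1) by (simp add: wlim_def)
next
  assume *: "\<forall>F\<in>carr (bidual V). G F = wlim V F g"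
  \<comment> \<open>Off \<open>carr (bidual V)\<close> both sides are 0, so they agree as
    functions.\<close>
  have "zext (bidual V) G = emb (dual V) (zext V g)"
    using * by (auto simp: zext_def[of "bidual V"] emb_def wlim_def)
  then show "zext (bidual V) G \<in> canon (dual V)"
    using zext_mem_dual[OF V g] by (auto simp: canon_def)
qed


lemma tap_dom_tflip:
  "tap (tflip f) z y x = tap f x y z" "tdom1 (tflip f) = tdom3 f" "tdom2 (tflip f) = tdom2 f"
  "tdom3 (tflip f) = tdom1 f" "tcod (tflip f) = tcod f"
  by (simp_all add: tflip_def)

text \<open>The first functional belongs to the first variable, and its limit is the outermost. An
  interchange of limits is thus written by permuting the functionals together with the bound
  variables, as in \<open>\<lambda>p s q r. rform x' p q r s\<close>.\<close>

abbreviation wlim2 where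
  "wlim2 V F G f \<equiv> wlim V F (\<lambda>x. wlim V G (f x))"

abbreviation wlim3 where
  "wlim3 V F G H f \<equiv> wlim V F (\<lambda>x. wlim2 V G H (f x))"

abbreviation wlim4 where
  "wlim4 V F G H K f \<equiv> wlim V F (\<lambda>x. wlim3 V G H K (f x))"

text \<open>\<open>wlim_add\<close> needs bounded forms, so it is applied once per limit from the
  innermost outwards, with the inner expressions covered by the lemmas on \<open>form2\<close>,
  \<open>form3\<close> and \<open>form4\<close>.\<close>

lemma wlim4_add:
  assumes V: "normed_space V"
    and F: "F \<in> carr (bidual V)" and G: "G \<in> carr (bidual V)"
    and H: "H \<in> carr (bidual V)" and K: "K \<in> carr (bidual V)"
    and f: "form4 V f" and g: "form4 V g"
  shows "wlim4 V F G H K (\<lambda>x y z w. f x y z w + g x y z w)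
    = wlim4 V F G H K f + wlim4 V F G H K g"
proof -
  note f3 = form4_apply[OF V f] and g3 = form4_apply[OF V g]
  note f2 = form3_apply[OF V f3] and g2 = form3_apply[OF V g3]
  note [simp] = wlim_add[OF V K form2_apply[OF f2] form2_apply[OF g2]]
    wlim_add[OF V H form2_wlim[OF V K f2] form2_wlim[OF V K g2]]
    wlim_add[OF V G form2_wlim[OF V H form3_wlim[OF V K f3]] form2_wlim[OF V H form3_wlim[OF V K g3]]]
    wlim_add[OF V F form2_wlim[OF V G form3_wlim[OF V H form4_wlim[OF V K f]]]
      form2_wlim[OF V G form3_wlim[OF V H form4_wlim[OF V K g]]]]
  have "wlim4 V F G H K (\<lambda>x y z w. f x y z w + g x y z w)
    = wlim3 V F G H (\<lambda>x y z. wlim V K (f x y z) + wlim V K (g x y z))"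
    by (intro wlim_cong) simp
  also have "\<dots> = wlim2 V F G (\<lambda>x y. wlim2 V H K (f x y) + wlim2 V H K (g x y))"
    by (intro wlim_cong) simp
  also have "\<dots> = wlim V F (\<lambda>x. wlim3 V G H K (f x) + wlim3 V G H K (g x))"
    by (intro wlim_cong) simp
  finally show ?thesis by simp
qed

text \<open>For \<open>m = \<pi>\<close> this is the first Arens product as an iterated limit of
  products in \<open>V\<close>, the limit along the left factor being outermost.\<close>

lemma wlim_badj3:
  assumes V: "normed_space V" and m: "m \<in> bounded_bilinear_maps V V V"
    and f: "bounded_form V f"
  shows "wlim V (bap (badj3 m) F G) f = wlim2 V F G (\<lambda>x y. f (bap m x y))"
proof -
  note mD = bounded_bilinear_mapsD[OF m]
  have "bap (badj3 m) F G (zext V f) = wlim2 V F G (\<lambda>x y. zext V f (bap m x y))"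
    using zext_mem_dual[OF V f] by (simp add: bap_badj mD wlim_def)
  also have "\<dots> = wlim2 V F G (\<lambda>x y. f (bap m x y))"
    using mD(6) by (intro wlim_cong) simp
  finally show ?thesis by (simp add: wlim_def)
qed

section \<open>Tri-derivations\<close>

locale banach_module_tri_derivation =
  fixes A :: "('k::real_normed_field, 'a::ab_group_add) nspace"
    and X :: "('k, 'x::ab_group_add) nspace"
    and \<pi> :: "('k, 'a, 'a, 'a) bimap"
    and \<pi>1 :: "('k, 'a, 'x, 'x) bimap"
    and \<pi>2 :: "('k, 'x, 'a, 'x) bimap"
    and D :: "('k, 'a, 'a, 'a, 'x) trimap"
  assumes algebra: "banach_algebra A \<pi>"
    and module: "banach_module A \<pi> \<pi>1 X \<pi>2"
    and bounded: "D \<in> bounded_trilinear_maps A A A X"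
    and derivation: "tri_derivation A \<pi> \<pi>1 \<pi>2 D"
begin

lemma A: "normed_space A" and X: "normed_space X"
  using algebra module by (auto simp: banach_algebra_def banach_module_def banach_space_def)

lemma mult: "\<pi> \<in> bounded_bilinear_maps A A A"
  and left: "\<pi>1 \<in> bounded_bilinear_maps A X X"
  and right: "\<pi>2 \<in> bounded_bilinear_maps X A X"
  using algebra module by (auto simp: banach_algebra_def banach_module_def)

lemmas leftD = bounded_bilinear_mapsD[OF left]
lemmas rightD = bounded_bilinear_mapsD[OF right]
lemmas DD = bounded_trilinear_mapsD[OF bounded]

lemma normed_duals:
  "normed_space (dual A)" "normed_space (dual X)" "normed_space (bidual A)"
  "normed_space (bidual X)" "normed_space (dual (bidual A))" "normed_space (dual (bidual X))"
  by (intro normed_space_dual A X)+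

text \<open>The digit in a name counts the adjoints taken. The memberships derived from these facts
  are needed since functionals and \<open>emb\<close> are cut off to 0 outside the carriers.\<close>

lemmas mult3 = badj_bounded[OF normed_duals(3,1,1)
    badj_bounded[OF normed_duals(1) A normed_duals(1) badj_bounded[OF A A A mult]]]
lemmas left1 = badj_bounded[OF A X X left]
lemmas left3 = badj_bounded[OF normed_duals(4,2,1)
    badj_bounded[OF normed_duals(2) A normed_duals(2) left1]]
lemmas left4 = badj_bounded[OF normed_duals(3) normed_duals(4) normed_duals(4) left3]
lemmas right2 = badj_bounded[OF normed_duals(2) X normed_duals(1) badj_bounded[OF X A X right]]
lemmas right3 = badj_bounded[OF normed_duals(3,2,2) right2]
lemmas D4 = tadj_bounded[OF normed_duals(3,3,2,1)
    tadj_bounded[OF normed_duals(3,2) A normed_duals(1)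
      tadj_bounded[OF normed_duals(2) A A normed_duals(1) tadj_bounded[OF A A A X bounded]]]]
lemmas D5 = tadj_bounded[OF normed_duals(3,3,3,4) D4]
lemmas D6 = tadj_bounded[OF normed_duals(6,3,3,5) D5]

lemmas mult3_mem = bounded_bilinear_mapsD(6)[OF mult3]
lemmas left1_mem = bounded_bilinear_mapsD(6)[OF left1]
lemmas left3_mem = bounded_bilinear_mapsD(6)[OF left3]
lemmas left4_mem = bounded_bilinear_mapsD(6)[OF left4]
lemmas right2_mem = bounded_bilinear_mapsD(6)[OF right2]
lemmas right3_mem = bounded_bilinear_mapsD(6)[OF right3]
lemmas D4_mem = bounded_trilinear_mapsD(8)[OF D4]
lemmas D5_mem = bounded_trilinear_mapsD(8)[OF D5]
lemmas D6_mem = bounded_trilinear_mapsD(8)[OF D6]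

text \<open>The arguments are listed in the order in which they stand in \<open>D(p,q,r) s\<close>
  and \<open>p D(q,r,s)\<close>, so that the module actions on \<open>tadj4 D\<close> become
  iterated limits of these forms without a permutation.\<close>

definition rform where "rform x' p q r s = x' (bap \<pi>2 (tap D p q r) s)"
definition lform where "lform x' p q r s = x' (bap \<pi>1 p (tap D q r s))"

text \<open>The bound is the product of the bounds of \<open>x'\<close>, \<open>\<pi>2\<close> and
  \<open>D\<close>; the first three variables enter linearly through \<open>D\<close>, the last
  through \<open>\<pi>2\<close>.\<close>

lemma form4_rform:
  assumes x': "x' \<in> carr (dual X)"
  shows "form4 A (rform x')"
proof -
  obtain B where B: "B \<ge> 0" "\<And>x y z. x \<in> carr A \<Longrightarrow> y \<in> carr A \<Longrightarrow> z \<in> carr A \<Longrightarrow>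
       nrm X (tap D x y z) \<le> B * nrm A x * nrm A y * nrm A z"
    using bounded_trilinear_maps_bound[OF A A A bounded] by blast
  obtain C where C: "C \<ge> 0" "\<And>x y. x \<in> carr X \<Longrightarrow> y \<in> carr A \<Longrightarrow>
       nrm X (bap \<pi>2 x y) \<le> C * nrm X x * nrm A y"
    using bounded_bilinear_maps_bound[OF X A right] by blast
  note N = normed_spaceD(7)[OF A]
  have x'_nonneg: "nrm (dual X) x' \<ge> 0"
    using nrm_dual_nonneg[OF X dualD(2)[OF x']] .
  have "norm (rform x' p q r s)
      \<le> (nrm (dual X) x' * C * B) * nrm A p * nrm A q * nrm A r * nrm A s"
    if "p \<in> carr A" "q \<in> carr A" "r \<in> carr A" "s \<in> carr A" for p q r s
  proof -
    have "norm (rform x' p q r s) \<le> nrm (dual X) x' * nrm X (bap \<pi>2 (tap D p q r) s)"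
      using norm_le_nrm_dual[OF X dualD(2)[OF x'] rightD(6)[OF DD(8)[OF that(1-3)] that(4)]]
      by (simp add: rform_def)
    also have "\<dots> \<le> nrm (dual X) x' * (C * nrm X (tap D p q r) * nrm A s)"
      using x'_nonneg C(2) DD(8) that by (intro mult_left_mono) auto
    also have "\<dots> \<le> nrm (dual X) x' * (C * (B * nrm A p * nrm A q * nrm A r) * nrm A s)"
      using x'_nonneg C(1) B(2) N that by (intro mult_left_mono mult_right_mono) auto
    finally show ?thesis by (simp add: mult.assoc)
  qed
  moreover have "nrm (dual X) x' * C * B \<ge> 0"
    using x'_nonneg B(1) C(1) by simp
  ultimately have bnd: "\<exists>B\<ge>0. \<forall>p\<in>carr A. \<forall>q\<in>carr A. \<forall>r\<in>carr A. \<forall>s\<in>carr A.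
      norm (rform x' p q r s) \<le> B * nrm A p * nrm A q * nrm A r * nrm A s"
    by blast
  note comp = linear_map_comp[OF _ linear_map_comp[OF rightD(4) dualD(1)[OF x']]]
  show ?thesis
    unfolding form4_def
  proof (intro conjI ballI bnd)
    fix y z w assume "y \<in> carr A" "z \<in> carr A" "w \<in> carr A"
    then show "linear_map A scalars (\<lambda>x. rform x' x y z w)"
      unfolding rform_def[abs_def] by (intro comp[OF DD(5)])
  next
    fix x z w assume "x \<in> carr A" "z \<in> carr A" "w \<in> carr A"
    then show "linear_map A scalars (\<lambda>y. rform x' x y z w)"
      unfolding rform_def[abs_def] by (intro comp[OF DD(6)])
  next
    fix x y w assume "x \<in> carr A" "y \<in> carr A" "w \<in> carr A"
    then show "linear_map A scalars (\<lambda>z. rform x' x y z w)"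
      unfolding rform_def[abs_def] by (intro comp[OF DD(7)])
  next
    fix x y z assume "x \<in> carr A" "y \<in> carr A" "z \<in> carr A"
    then show "linear_map A scalars (rform x' x y z)"
      unfolding rform_def[abs_def] by (intro linear_map_comp[OF rightD(5)[OF DD(8)] dualD(1)[OF x']])
  qed
qed

lemma form4_lform:
  assumes x': "x' \<in> carr (dual X)"
  shows "form4 A (lform x')"
proof -
  obtain B where B: "B \<ge> 0" "\<And>x y z. x \<in> carr A \<Longrightarrow> y \<in> carr A \<Longrightarrow> z \<in> carr A \<Longrightarrow>
       nrm X (tap D x y z) \<le> B * nrm A x * nrm A y * nrm A z"
    using bounded_trilinear_maps_bound[OF A A A bounded] by blast
  obtain C where C: "C \<ge> 0" "\<And>x y. x \<in> carr A \<Longrightarrow> y \<in> carr X \<Longrightarrow>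
       nrm X (bap \<pi>1 x y) \<le> C * nrm A x * nrm X y"
    using bounded_bilinear_maps_bound[OF A X left] by blast
  note N = normed_spaceD(7)[OF A]
  have x'_nonneg: "nrm (dual X) x' \<ge> 0"
    using nrm_dual_nonneg[OF X dualD(2)[OF x']] .
  have "norm (lform x' p q r s)
      \<le> (nrm (dual X) x' * C * B) * nrm A p * nrm A q * nrm A r * nrm A s"
    if "p \<in> carr A" "q \<in> carr A" "r \<in> carr A" "s \<in> carr A" for p q r s
  proof -
    have "norm (lform x' p q r s) \<le> nrm (dual X) x' * nrm X (bap \<pi>1 p (tap D q r s))"
      using norm_le_nrm_dual[OF X dualD(2)[OF x'] leftD(6)[OF that(1) DD(8)[OF that(2-4)]]]
      by (simp add: lform_def)
    also have "\<dots> \<le> nrm (dual X) x' * (C * nrm A p * nrm X (tap D q r s))"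
      using x'_nonneg C(2) DD(8) that by (intro mult_left_mono) auto
    also have "\<dots> \<le> nrm (dual X) x' * (C * nrm A p * (B * nrm A q * nrm A r * nrm A s))"
      using x'_nonneg C(1) B(2) N that by (intro mult_left_mono) auto
    finally show ?thesis by (simp add: algebra_simps)
  qed
  moreover have "nrm (dual X) x' * C * B \<ge> 0"
    using x'_nonneg B(1) C(1) by simp
  ultimately have bnd: "\<exists>B\<ge>0. \<forall>p\<in>carr A. \<forall>q\<in>carr A. \<forall>r\<in>carr A. \<forall>s\<in>carr A.
      norm (lform x' p q r s) \<le> B * nrm A p * nrm A q * nrm A r * nrm A s"
    by blast
  note comp = linear_map_comp[OF _ linear_map_comp[OF leftD(5) dualD(1)[OF x']]]
  show ?thesis
    unfolding form4_def
  proof (intro conjI ballI bnd)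
    fix y z w assume "y \<in> carr A" "z \<in> carr A" "w \<in> carr A"
    then show "linear_map A scalars (\<lambda>x. lform x' x y z w)"
      unfolding lform_def[abs_def] by (intro linear_map_comp[OF leftD(4)[OF DD(8)] dualD(1)[OF x']])
  next
    fix x z w assume "x \<in> carr A" "z \<in> carr A" "w \<in> carr A"
    then show "linear_map A scalars (\<lambda>y. lform x' x y z w)"
      unfolding lform_def[abs_def] by (intro comp[OF DD(5)])
  next
    fix x y w assume "x \<in> carr A" "y \<in> carr A" "w \<in> carr A"
    then show "linear_map A scalars (\<lambda>z. lform x' x y z w)"
      unfolding lform_def[abs_def] by (intro comp[OF DD(6)])
  next
    fix x y z assume "x \<in> carr A" "y \<in> carr A" "z \<in> carr A"
    then show "linear_map A scalars (lform x' x y z)"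
      unfolding lform_def[abs_def] by (intro comp[OF DD(7)])
  qed
qed

text \<open>Each adjoint applies one functional to the expression built so far: first
  \<open>x'\<close>, then \<open>c\<close>, \<open>b\<close> and \<open>a\<close>. Hence the limit
  along \<open>a\<close> is outermost.\<close>

lemma D4_apply:
  assumes "x' \<in> carr (dual X)"
  shows "tap (tadj4 D) a b c x' = wlim3 A a b c (\<lambda>p q r. x' (tap D p q r))"
  using assms by (simp add: tap_tadj DD wlim_def)

lemma right3_D4_apply:
  assumes x': "x' \<in> carr (dual X)" and d: "d \<in> carr (bidual A)"
  shows "bap (badj3 \<pi>2) (tap (tadj4 D) a b c) d x' = wlim4 A a b c d (rform x')"
proof -
  \<comment> \<open>The right action of \<open>d\<close> is moved to \<open>x'\<close>:
    \<open>?y\<close> is the functional sending \<open>u\<close> to the limit of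
    \<open>x' (bap \<pi>2 u s)\<close> along \<open>d\<close>. As the new argument of
    \<open>tadj4 D\<close> it makes the limit along \<open>d\<close> innermost.\<close>
  let ?y = "bap (badj (badj \<pi>2)) d x'"
  have "bap (badj3 \<pi>2) (tap (tadj4 D) a b c) d x' = tap (tadj4 D) a b c ?y"
    using x' by (simp add: bap_badj[of "badj (badj \<pi>2)"] rightD)
  also have "\<dots> = wlim3 A a b c (\<lambda>p q r. ?y (tap D p q r))"
    using right2_mem[OF d x'] by (rule D4_apply)
  also have "\<dots> = wlim4 A a b c d (rform x')"
    using DD(8) by (intro wlim_cong) (simp add: bap_badj rightD wlim_def rform_def[abs_def])
  finally show ?thesis .
qed

lemma left3_D4_apply:
  assumes x': "x' \<in> carr (dual X)"
  shows "bap (badj3 \<pi>1) d (tap (tadj4 D) a b c) x' = wlim4 A d a b c (lform x')"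
proof -
  have "bap (badj3 \<pi>1) d (tap (tadj4 D) a b c) x'
      = wlim A d (\<lambda>p. tap (tadj4 D) a b c (bap (badj \<pi>1) x' p))"
    using x' by (simp add: bap_badj[of "badj (badj \<pi>1)"] bap_badj[of "badj \<pi>1"] leftD wlim_def)
  \<comment> \<open>For each \<open>p\<close> in \<open>A\<close> the functional sending
    \<open>u\<close> to \<open>x' (bap \<pi>1 p u)\<close> lies in \<open>dual X\<close>, so
    \<open>D4_apply\<close> can be used under the outer limit along \<open>d\<close>.\<close>
  also have "\<dots> = wlim A d (\<lambda>p. wlim3 A a b c (\<lambda>q r s. bap (badj \<pi>1) x' p (tap D q r s)))"
    using left1_mem[OF x'] by (intro wlim_cong D4_apply)
  also have "\<dots> = wlim4 A d a b c (lform x')"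
    using DD(8) by (intro wlim_cong) (simp add: bap_badj leftD lform_def)
  finally show ?thesis .
qed

end


section \<open>Value sets, permuted forms and membership in the canonical image\<close>

lemma bvals_subset_iff: "bvals m P Q \<subseteq> S \<longleftrightarrow> (\<forall>p\<in>P. \<forall>q\<in>Q. bap m p q \<in> S)"
  unfolding bvals_def by blast

lemma tvals_subset_iff: "tvals f P Q R \<subseteq> S \<longleftrightarrow> (\<forall>p\<in>P. \<forall>q\<in>Q. \<forall>r\<in>R. tap f p q r \<in> S)"
  unfolding tvals_def by blast

lemma ball_bvals: "(\<forall>u\<in>bvals m P Q. \<Phi> u) \<longleftrightarrow> (\<forall>p\<in>P. \<forall>q\<in>Q. \<Phi> (bap m p q))"
  unfolding bvals_def by blast

lemma ball_tvals: "(\<forall>u\<in>tvals f P Q R. \<Phi> u) \<longleftrightarrow> (\<forall>p\<in>P. \<forall>q\<in>Q. \<forall>r\<in>R. \<Phi> (tap f p q r))"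
  unfolding tvals_def by blast

lemma ball_canon: "(\<forall>u\<in>canon V. \<Phi> u) \<longleftrightarrow> (\<forall>x\<in>carr V. \<Phi> (emb V x))"
  unfolding canon_def by blast

text \<open>Interchanging limits permutes the variables of a form; the adjacent transpositions
  generate the permutations that occur.\<close>

lemma form4_swap12:
  assumes "form4 V f" shows "form4 V (\<lambda>y x z w. f x y z w)"
proof -
  obtain B where "B \<ge> 0" and B: "\<forall>x\<in>carr V. \<forall>y\<in>carr V. \<forall>z\<in>carr V. \<forall>w\<in>carr V.
      norm (f x y z w) \<le> B * nrm V x * nrm V y * nrm V z * nrm V w"
    using assms unfolding form4_def by blast
  have "norm (f x y z w) \<le> B * nrm V y * nrm V x * nrm V z * nrm V w"
    if "x \<in> carr V" "y \<in> carr V" "z \<in> carr V" "w \<in> carr V" for x y z w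
    using B[rule_format, OF that] by (simp add: mult_ac)
  then have "\<exists>B\<ge>0. \<forall>y\<in>carr V. \<forall>x\<in>carr V. \<forall>z\<in>carr V. \<forall>w\<in>carr V.
      norm (f x y z w) \<le> B * nrm V y * nrm V x * nrm V z * nrm V w"
    using \<open>B \<ge> 0\<close> by blast
  then show ?thesis
    using assms unfolding form4_def by simp
qed

lemma form4_swap23:
  assumes "form4 V f" shows "form4 V (\<lambda>x z y w. f x y z w)"
proof -
  obtain B where "B \<ge> 0" and B: "\<forall>x\<in>carr V. \<forall>y\<in>carr V. \<forall>z\<in>carr V. \<forall>w\<in>carr V.
      norm (f x y z w) \<le> B * nrm V x * nrm V y * nrm V z * nrm V w"
    using assms unfolding form4_def by blast
  have "norm (f x y z w) \<le> B * nrm V x * nrm V z * nrm V y * nrm V w"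
    if "x \<in> carr V" "y \<in> carr V" "z \<in> carr V" "w \<in> carr V" for x y z w
    using B[rule_format, OF that] by (simp add: mult_ac)
  then have "\<exists>B\<ge>0. \<forall>x\<in>carr V. \<forall>z\<in>carr V. \<forall>y\<in>carr V. \<forall>w\<in>carr V.
      norm (f x y z w) \<le> B * nrm V x * nrm V z * nrm V y * nrm V w"
    using \<open>B \<ge> 0\<close> by blast
  then show ?thesis
    using assms unfolding form4_def by simp
qed

lemma form4_swap34:
  assumes "form4 V f" shows "form4 V (\<lambda>x y w z. f x y z w)"
proof -
  obtain B where "B \<ge> 0" and B: "\<forall>x\<in>carr V. \<forall>y\<in>carr V. \<forall>z\<in>carr V. \<forall>w\<in>carr V.
      norm (f x y z w) \<le> B * nrm V x * nrm V y * nrm V z * nrm V w"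
    using assms unfolding form4_def by blast
  have "norm (f x y z w) \<le> B * nrm V x * nrm V y * nrm V w * nrm V z"
    if "x \<in> carr V" "y \<in> carr V" "z \<in> carr V" "w \<in> carr V" for x y z w
    using B[rule_format, OF that] by (simp add: mult_ac)
  then have "\<exists>B\<ge>0. \<forall>x\<in>carr V. \<forall>y\<in>carr V. \<forall>w\<in>carr V. \<forall>z\<in>carr V.
      norm (f x y z w) \<le> B * nrm V x * nrm V y * nrm V w * nrm V z"
    using \<open>B \<ge> 0\<close> by blast
  then show ?thesis
    using assms unfolding form4_def by simp
qed

lemma form2_swap:
  assumes "form2 V f" shows "form2 V (\<lambda>y x. f x y)"
proof -
  obtain B where "B \<ge> 0" and B: "\<forall>x\<in>carr V. \<forall>y\<in>carr V. norm (f x y) \<le> B * nrm V x * nrm V y"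
    using assms unfolding form2_def by blast
  have "norm (f x y) \<le> B * nrm V y * nrm V x"
    if "x \<in> carr V" "y \<in> carr V" for x y
    using B[rule_format, OF that] by (simp add: mult_ac)
  then have "\<exists>B\<ge>0. \<forall>y\<in>carr V. \<forall>x\<in>carr V.
      norm (f x y) \<le> B * nrm V y * nrm V x"
    using \<open>B \<ge> 0\<close> by blast
  then show ?thesis
    using assms unfolding form2_def by simp
qed

lemma form3_rotate:
  assumes "form3 V f" shows "form3 V (\<lambda>z x y. f x y z)"
proof -
  obtain B where "B \<ge> 0" and B: "\<forall>x\<in>carr V. \<forall>y\<in>carr V. \<forall>z\<in>carr V.
      norm (f x y z) \<le> B * nrm V x * nrm V y * nrm V z"
    using assms unfolding form3_def by blast
  have "norm (f x y z) \<le> B * nrm V z * nrm V x * nrm V y"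
    if "x \<in> carr V" "y \<in> carr V" "z \<in> carr V" for x y z
    using B[rule_format, OF that] by (simp add: mult_ac)
  then have "\<exists>B\<ge>0. \<forall>z\<in>carr V. \<forall>x\<in>carr V. \<forall>y\<in>carr V.
      norm (f x y z) \<le> B * nrm V z * nrm V x * nrm V y"
    using \<open>B \<ge> 0\<close> by blast
  then show ?thesis
    using assms unfolding form3_def by simp
qed

text \<open>At \<open>G = emb V s\<close> the inner limit is the value at \<open>s\<close>. So the
  restriction to \<open>V\<close> is a limit along \<open>F\<close> only, and its limit along
  \<open>G\<close> has the two limits in the opposite order.\<close>

lemma wlim2_mem_canon_iff:
  assumes V: "normed_space V" and F: "F \<in> carr (bidual V)" and f: "form2 V f"
  shows "zext (bidual V) (\<lambda>G. wlim2 V F G f) \<in> canon (dual V)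
    \<longleftrightarrow> (\<forall>G\<in>carr (bidual V). wlim2 V F G f = wlim2 V G F (\<lambda>y x. f x y))"
proof (rule zext_mem_canon_dual_iff[OF V form2_wlim[OF V F form2_swap[OF f]]])
  show "wlim2 V F (emb V s) f = wlim V F (\<lambda>x. f x s)" if "s \<in> carr V" for s
    using wlim_emb[OF V that form2_apply[OF f]] by (intro wlim_cong)
qed

lemma wlim3_mem_canon_iff:
  assumes V: "normed_space V" and F: "F \<in> carr (bidual V)" and G: "G \<in> carr (bidual V)"
    and f: "form3 V f"
  shows "zext (bidual V) (\<lambda>H. wlim3 V F G H f) \<in> canon (dual V)
    \<longleftrightarrow> (\<forall>H\<in>carr (bidual V). wlim3 V F G H f = wlim3 V H F G (\<lambda>z x y. f x y z))"
proof (rule zext_mem_canon_dual_iff[OF V form2_wlim[OF V F form3_wlim[OF V G form3_rotate[OF f]]]])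
  show "wlim3 V F G (emb V s) f = wlim2 V F G (\<lambda>x y. f x y s)" if "s \<in> carr V" for s
    using wlim_emb[OF V that form2_apply[OF form3_apply[OF V f]]] by (intro wlim_cong)
qed

section \<open>The derivation identities on the second dual as equations of limits\<close>

context banach_module_tri_derivation
begin

lemma dual_D_mult:
  assumes x': "x' \<in> carr (dual X)"
    and "p \<in> carr A" "q \<in> carr A" "r \<in> carr A" "s \<in> carr A"
  shows "x' (tap D (bap \<pi> p s) q r) = rform x' p q r s + lform x' p s q r"
    and "x' (tap D p (bap \<pi> q s) r) = rform x' p q r s + lform x' q p s r"
    and "x' (tap D p q (bap \<pi> r s)) = rform x' p q r s + lform x' r p q s"
  using derivation assms(2-) dualD(3)[OF x'] DD(8) leftD(6) rightD(6)
  by (simp_all add: tri_derivation_def rform_def lform_def)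

lemma form3_dual_D:
  assumes x': "x' \<in> carr (dual X)"
  shows "form3 A (\<lambda>p q r. x' (tap D p q r))"
proof -
  obtain B where B: "B \<ge> 0" "\<And>x y z. x \<in> carr A \<Longrightarrow> y \<in> carr A \<Longrightarrow> z \<in> carr A \<Longrightarrow>
       nrm X (tap D x y z) \<le> B * nrm A x * nrm A y * nrm A z"
    using bounded_trilinear_maps_bound[OF A A A bounded] by blast
  have x'_nonneg: "nrm (dual X) x' \<ge> 0"
    using nrm_dual_nonneg[OF X dualD(2)[OF x']] .
  have "norm (x' (tap D p q r)) \<le> (nrm (dual X) x' * B) * nrm A p * nrm A q * nrm A r"
    if "p \<in> carr A" "q \<in> carr A" "r \<in> carr A" for p q r
  proof -
    have "norm (x' (tap D p q r)) \<le> nrm (dual X) x' * nrm X (tap D p q r)"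
      by (rule norm_le_nrm_dual[OF X dualD(2)[OF x'] DD(8)[OF that]])
    also have "\<dots> \<le> nrm (dual X) x' * (B * nrm A p * nrm A q * nrm A r)"
      using x'_nonneg B(2) that by (intro mult_left_mono) auto
    finally show ?thesis by (simp add: mult.assoc)
  qed
  moreover have "nrm (dual X) x' * B \<ge> 0"
    using x'_nonneg B(1) by simp
  ultimately have bnd: "\<exists>B\<ge>0. \<forall>p\<in>carr A. \<forall>q\<in>carr A. \<forall>r\<in>carr A.
      norm (x' (tap D p q r)) \<le> B * nrm A p * nrm A q * nrm A r"
    by blast
  note comp = linear_map_comp[OF _ dualD(1)[OF x']]
  show ?thesis
    unfolding form3_def using bnd comp[OF DD(5)] comp[OF DD(6)] comp[OF DD(7)] by simp
qed

context
  fixes a b c d x'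
  assumes a: "a \<in> carr (bidual A)" and b: "b \<in> carr (bidual A)" and c: "c \<in> carr (bidual A)"
    and d: "d \<in> carr (bidual A)" and x': "x' \<in> carr (dual X)"
begin

text \<open>\<open>wlim_badj3\<close> splits the limit along the Arens product into limits along
  \<open>a\<close> and \<open>d\<close>, and \<open>D\<close> is expanded on the resulting products
  in \<open>A\<close>. The two new variables are adjacent, which places the limit along
  \<open>d\<close> before those along \<open>b\<close> and \<open>c\<close>.\<close>

lemma D4_mult1:
  "tap (tadj4 D) (bap (badj3 \<pi>) a d) b c x'
    = wlim4 A a d b c (\<lambda>p s q r. rform x' p q r s) + wlim4 A a d b c (lform x')"
proof -
  have bf: "bounded_form A (\<lambda>t. wlim2 A b c (\<lambda>q r. x' (tap D t q r)))"
    by (intro form2_wlim form3_wlim form3_dual_D A b c x')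
  have "tap (tadj4 D) (bap (badj3 \<pi>) a d) b c x'
      = wlim4 A a d b c (\<lambda>p s q r. x' (tap D (bap \<pi> p s) q r))"
    unfolding D4_apply[OF x'] by (rule wlim_badj3[OF A mult bf])
  also have "\<dots> = wlim4 A a d b c (\<lambda>p s q r. rform x' p q r s + lform x' p s q r)"
    using dual_D_mult(1)[OF x'] by (intro wlim_cong) simp
  also have "\<dots> = wlim4 A a d b c (\<lambda>p s q r. rform x' p q r s) + wlim4 A a d b c (lform x')"
    by (intro wlim4_add A a b c d form4_lform x' form4_swap23[OF form4_swap34[OF form4_rform[OF x']]])
  finally show ?thesis .
qed

lemma D4_mult2:
  "tap (tadj4 D) a (bap (badj3 \<pi>) b d) c x'
    = wlim4 A a b d c (\<lambda>p q s r. rform x' p q r s) + wlim4 A a b d c (\<lambda>q p r s. lform x' p q r s)"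
proof -
  \<comment> \<open>The product sits in the second slot, so its limit is split for fixed
    \<open>p\<close> under the outer limit along \<open>a\<close>.\<close>
  have bf: "bounded_form A (\<lambda>t. wlim A c (\<lambda>r. x' (tap D p t r)))" if "p \<in> carr A" for p
    by (intro form2_wlim form3_apply[OF A form3_dual_D] A c x' that)
  have "tap (tadj4 D) a (bap (badj3 \<pi>) b d) c x'
      = wlim4 A a b d c (\<lambda>p q s r. x' (tap D p (bap \<pi> q s) r))"
    unfolding D4_apply[OF x'] using wlim_badj3[OF A mult bf] by (intro wlim_cong)
  also have "\<dots> = wlim4 A a b d c (\<lambda>p q s r. rform x' p q r s + lform x' q p s r)"
    using dual_D_mult(2)[OF x'] by (intro wlim_cong) simp
  also have "\<dots> = wlim4 A a b d c (\<lambda>p q s r. rform x' p q r s)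
      + wlim4 A a b d c (\<lambda>q p r s. lform x' p q r s)"
    by (intro wlim4_add A a b c d form4_swap12[OF form4_lform[OF x']] form4_swap34[OF form4_rform[OF x']])
  finally show ?thesis .
qed

lemma D4_mult3:
  "tap (tadj4 D) a b (bap (badj3 \<pi>) c d) x'
    = wlim4 A a b c d (rform x') + wlim4 A a b c d (\<lambda>q r p s. lform x' p q r s)"
proof -
  have bf: "bounded_form A (\<lambda>t. x' (tap D p q t))" if "p \<in> carr A" "q \<in> carr A" for p q
    by (rule form2_apply[OF form3_apply[OF A form3_dual_D[OF x'] that(1)] that(2)])
  have "tap (tadj4 D) a b (bap (badj3 \<pi>) c d) x'
      = wlim4 A a b c d (\<lambda>p q r s. x' (tap D p q (bap \<pi> r s)))"
    unfolding D4_apply[OF x'] using wlim_badj3[OF A mult bf] by (intro wlim_cong)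
  also have "\<dots> = wlim4 A a b c d (\<lambda>p q r s. rform x' p q r s + lform x' r p q s)"
    using dual_D_mult(3)[OF x'] by (intro wlim_cong) simp
  also have "\<dots> = wlim4 A a b c d (rform x') + wlim4 A a b c d (\<lambda>q r p s. lform x' p q r s)"
    by (intro wlim4_add A a b c d form4_rform x' form4_swap23[OF form4_swap12[OF form4_lform[OF x']]])
  finally show ?thesis .
qed

end

text \<open>In the first identity the \<open>lform\<close> terms agree on both sides and cancel, in
  the third the \<open>rform\<close> terms do. In the second nothing cancels yet, which is why a sum
  remains.\<close>

lemma tri_derivation_D4_iff:
  "tri_derivation (bidual A) (badj3 \<pi>) (badj3 \<pi>1) (badj3 \<pi>2) (tadj4 D) \<longleftrightarrow>
    (\<forall>a\<in>carr (bidual A). \<forall>b\<in>carr (bidual A). \<forall>c\<in>carr (bidual A). \<forall>d\<in>carr (bidual A).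
      \<forall>x'\<in>carr (dual X).
        wlim4 A a d b c (\<lambda>p s q r. rform x' p q r s) = wlim4 A a b c d (rform x') \<and>
        wlim4 A a b d c (\<lambda>p q s r. rform x' p q r s) + wlim4 A a b d c (\<lambda>q p r s. lform x' p q r s)
          = wlim4 A a b c d (rform x') + wlim4 A b a d c (lform x') \<and>
        wlim4 A a b c d (\<lambda>q r p s. lform x' p q r s) = wlim4 A c a b d (lform x'))"
proof -
  \<comment> \<open>Elements of \<open>bidual X\<close> are compared by their values on
    \<open>dual X\<close>.\<close>
  have *: "u = v + w \<longleftrightarrow> (\<forall>x'\<in>carr (dual X). u x' = v x' + w x')"
    if "u \<in> carr (bidual X)" "v \<in> carr (bidual X)" "w \<in> carr (bidual X)" for u v w
    using dual_eq_iff[OF that(1) normed_spaceD(2)[OF normed_duals(4) that(2,3)]] by simp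
  show ?thesis
    unfolding tri_derivation_def
    by (intro ball_cong refl)
      (simp add: * mult3_mem left3_mem right3_mem D4_mem D4_mult1 D4_mult2 D4_mult3
        right3_D4_apply left3_D4_apply ball_conj_distrib)
qed

section \<open>Limits along elements of \<open>A\<close>, and the five conditions as equations of
  limits\<close>

lemma wlim4_rform_emb:
  assumes "x' \<in> carr (dual X)" "p \<in> carr A" "b \<in> carr (bidual A)" "c \<in> carr (bidual A)"
    "d \<in> carr (bidual A)"
  shows "wlim4 A (emb A p) b c d (rform x') = wlim3 A b c d (rform x' p)"
  by (intro wlim_emb form2_wlim form3_wlim form4_wlim form4_rform A assms)

lemma wlim4_rform_emb_swap:
  assumes "x' \<in> carr (dual X)" "p \<in> carr A" "b \<in> carr (bidual A)" "c \<in> carr (bidual A)"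
    "d \<in> carr (bidual A)"
  shows "wlim4 A (emb A p) d b c (\<lambda>p s q r. rform x' p q r s)
    = wlim3 A d b c (\<lambda>s q r. rform x' p q r s)"
  by (intro wlim_emb[where f = "\<lambda>p. wlim3 A d b c (\<lambda>s q r. rform x' p q r s)"]
      form2_wlim form3_wlim form4_wlim form4_swap23[OF form4_swap34[OF form4_rform]] A assms)

text \<open>The constant net is in the second slot, so it is evaluated for each \<open>p\<close>
  under the outer limit along \<open>d\<close>.\<close>

lemma wlim4_lform_emb:
  assumes "x' \<in> carr (dual X)" "q \<in> carr A" "d \<in> carr (bidual A)" "b \<in> carr (bidual A)"
    "c \<in> carr (bidual A)"
  shows "wlim4 A d (emb A q) b c (lform x') = wlim3 A d b c (\<lambda>p. lform x' p q)"
  by (intro wlim_cong wlim_emb[where f = "\<lambda>q. wlim2 A b c (lform x' _ q)"]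
      form2_wlim form3_wlim form4_apply form4_lform A assms)

lemma wlim4_lform_emb_swap:
  assumes "x' \<in> carr (dual X)" "q \<in> carr A" "b \<in> carr (bidual A)" "d \<in> carr (bidual A)"
    "c \<in> carr (bidual A)"
  shows "wlim4 A (emb A q) b d c (\<lambda>q r p s. lform x' p q r s)
    = wlim3 A b d c (\<lambda>r p s. lform x' p q r s)"
  by (intro wlim_emb[where f = "\<lambda>q. wlim3 A b d c (\<lambda>r p s. lform x' p q r s)"]
      form2_wlim form3_wlim form4_wlim form4_swap23[OF form4_swap12[OF form4_lform]] A assms)

text \<open>Both maps produce the functional sending \<open>d\<close> to
  \<open>bap (badj3 \<pi>2) u d x'\<close>. Condition (1) thus takes the shape of (2), with the
  second argument of \<open>tadj4 D\<close> restricted to \<open>A\<close>.\<close>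

lemma cond1_iff:
  "bvals (badj (bflip (badj (badj \<pi>2))))
      (tvals (tadj4 D) (canon A) (canon A) (carr (bidual A))) (carr (dual X)) \<subseteq> S
    \<longleftrightarrow> bvals (badj4 \<pi>2) (canon (dual X))
      (tvals (tadj4 D) (canon A) (canon A) (carr (bidual A))) \<subseteq> S"
proof -
  have "bap (badj (bflip (badj (badj \<pi>2)))) u x' = bap (badj4 \<pi>2) (emb (dual X) x') u"
    if "u \<in> carr (bidual X)" "x' \<in> carr (dual X)" for u x'
    unfolding bap_badj[of "badj3 \<pi>2"] bap_badj[of "bflip (badj (badj \<pi>2))"]
    using right3_mem[OF that(1)] that(2)
    by (auto simp: bflip_def rightD bap_badj[of "badj (badj \<pi>2)"] intro!: zext_cong)
  then show ?thesis
    using D4_mem emb_mem[OF A]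
    by (auto simp: bvals_subset_iff ball_tvals ball_canon)
qed

lemma badj4_right_D4_value:
  assumes "x' \<in> carr (dual X)" "p \<in> carr A" "b \<in> carr (bidual A)" "c \<in> carr (bidual A)"
  shows "bap (badj4 \<pi>2) (emb (dual X) x') (tap (tadj4 D) (emb A p) b c)
      = zext (bidual A) (\<lambda>d. wlim3 A b c d (rform x' p))"
  using assms wlim4_rform_emb emb_mem[OF A] right3_mem D4_mem
  by (auto simp: bap_badj[of "badj3 \<pi>2"] rightD right3_D4_apply intro!: zext_cong)

lemma cond2_iff:
  "bvals (badj4 \<pi>2) (canon (dual X))
      (tvals (tadj4 D) (canon A) (carr (bidual A)) (carr (bidual A))) \<subseteq> canon (dual A)
    \<longleftrightarrow> (\<forall>x'\<in>carr (dual X). \<forall>p\<in>carr A. \<forall>b\<in>carr (bidual A). \<forall>c\<in>carr (bidual A).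
      \<forall>d\<in>carr (bidual A).
        wlim3 A b c d (rform x' p) = wlim3 A d b c (\<lambda>s q r. rform x' p q r s))"
  by (simp add: bvals_subset_iff ball_tvals ball_canon badj4_right_D4_value
      wlim3_mem_canon_iff[OF A] form4_apply[OF A form4_rform])

text \<open>The values are functionals of one argument of \<open>tadj4 D\<close>: the first one
  here, the second one after six adjoints, and the first again after seven.\<close>

lemma tflip_D4_value:
  assumes "x' \<in> carr (dual X)" "b \<in> carr (bidual A)" "c \<in> carr (bidual A)" "d \<in> carr (bidual A)"
  shows "tap (tadj (tflip (tadj4 D))) (bap (badj4 \<pi>1) (emb (dual X) x') d) c b
    = zext (bidual A) (\<lambda>a. wlim4 A d a b c (lform x'))"
  using assms D4_mem left3_mem
  by (auto simp: tap_tadj[of "tflip (tadj4 D)"] tap_dom_tflip bap_badj[of "badj3 \<pi>1"] DD leftD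
      left3_D4_apply intro!: zext_cong)

lemma D6_value:
  assumes "x' \<in> carr (dual X)" "a \<in> carr (bidual A)" "c \<in> carr (bidual A)" "d \<in> carr (bidual A)"
  shows "tap (tadj6 D) (emb (bidual A) c) (bap (badj4 \<pi>1) (emb (dual X) x') d) a
    = zext (bidual A) (\<lambda>b. wlim4 A d a b c (lform x'))"
proof -
  \<comment> \<open>\<open>emb (bidual A) c\<close> evaluates at \<open>c\<close> only on the dual
    of \<open>bidual A\<close>. The membership \<open>*\<close> puts the value of the fifth adjoint
    there.\<close>
  have *: "bap (badj4 \<pi>1) (emb (dual X) x') d \<in> carr (dual (bidual X))"
    using assms emb_mem[OF normed_duals(2)] by (intro left4_mem)
  show ?thesis
    using assms D4_mem left3_mem D5_mem[OF *]
    by (auto simp: tap_tadj[of "tadj (tadj4 D)"] tap_tadj[of "tadj4 D"] bap_badj[of "badj3 \<pi>1"]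
        DD leftD left3_D4_apply intro!: zext_cong)
qed

lemma D7_value:
  assumes x': "x' \<in> carr (dual X)" and b: "b \<in> carr (bidual A)" and c: "c \<in> carr (bidual A)"
    and d: "d \<in> carr (bidual A)"
  shows "tap (tadj7 D) (emb (bidual A) b) (emb (bidual A) c) (bap (badj4 \<pi>1) (emb (dual X) x') d)
    = zext (bidual A) (\<lambda>a. wlim4 A d a b c (lform x'))"
proof -
  have *: "bap (badj4 \<pi>1) (emb (dual X) x') d \<in> carr (dual (bidual X))"
    using x' d emb_mem[OF normed_duals(2)] by (intro left4_mem)
  \<comment> \<open>The value of the sixth adjoint lies in the dual of \<open>bidual A\<close>, so
    \<open>emb (bidual A) b\<close> may be read as evaluation at \<open>b\<close>.\<close>
  have "zext (bidual A) (\<lambda>b. wlim4 A d a b c (lform x')) \<in> carr (dual (bidual A))"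
    if "a \<in> carr (bidual A)" for a
    using D6_mem[OF emb_mem[OF normed_duals(3) c] * that] D6_value[OF x' that c d] by simp
  then show ?thesis
    using assms by (auto simp: tap_tadj[of "tadj6 D"] DD D6_value intro!: zext_cong)
qed

text \<open>With the limits along \<open>b\<close> and \<open>c\<close> absorbed, a form in
  \<open>p\<close> and \<open>q\<close> is left, and the criterion for two variables applies to the
  two outer limits.\<close>

lemma wlim4_lform_mem_canon_iff1:
  assumes "x' \<in> carr (dual X)" "d \<in> carr (bidual A)" "b \<in> carr (bidual A)" "c \<in> carr (bidual A)"
  shows "zext (bidual A) (\<lambda>a. wlim4 A d a b c (lform x')) \<in> canon (dual A)
    \<longleftrightarrow> (\<forall>a\<in>carr (bidual A). wlim4 A d a b c (lform x')
          = wlim4 A a d b c (\<lambda>q p r s. lform x' p q r s))"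
  by (intro wlim2_mem_canon_iff[where f = "\<lambda>p q. wlim2 A b c (lform x' p q)"]
      form3_wlim form4_wlim form4_lform A assms)

lemma wlim4_lform_mem_canon_iff2:
  assumes "x' \<in> carr (dual X)" "q \<in> carr A" "d \<in> carr (bidual A)" "c \<in> carr (bidual A)"
  shows "zext (bidual A) (\<lambda>b. wlim4 A d (emb A q) b c (lform x')) \<in> canon (dual A)
    \<longleftrightarrow> (\<forall>b\<in>carr (bidual A). wlim3 A d b c (\<lambda>p. lform x' p q)
          = wlim3 A b d c (\<lambda>r p s. lform x' p q r s))"
proof -
  \<comment> \<open>Evaluating the constant net at \<open>q\<close> makes the limits along
    \<open>d\<close> and \<open>b\<close> adjacent, as the criterion for two variables
    requires.\<close>
  have "zext (bidual A) (\<lambda>b. wlim4 A d (emb A q) b c (lform x'))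
      = zext (bidual A) (\<lambda>b. wlim3 A d b c (\<lambda>p. lform x' p q))"
    using assms by (intro zext_cong wlim4_lform_emb)
  moreover have "form2 A (\<lambda>p r. wlim A c (lform x' p q r))"
    using form4_apply[OF A form4_swap12[OF form4_lform[OF assms(1)]] assms(2)]
    by (rule form3_wlim[OF A assms(4)])
  ultimately show ?thesis
    using wlim2_mem_canon_iff[OF A assms(3)] by simp
qed

text \<open>For \<open>p\<close> and \<open>q\<close> in \<open>A\<close>, condition (1)
  interchanges the two inner limits; the limits along \<open>a\<close> and \<open>b\<close> are then
  taken of equal functions.\<close>

lemma wlim4_rform_swap34:
  assumes C1: "bvals (badj (bflip (badj (badj \<pi>2))))
      (tvals (tadj4 D) (canon A) (canon A) (carr (bidual A))) (carr (dual X)) \<subseteq> canon (dual A)"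
    and x': "x' \<in> carr (dual X)" and a: "a \<in> carr (bidual A)" and b: "b \<in> carr (bidual A)"
    and c: "c \<in> carr (bidual A)" and d: "d \<in> carr (bidual A)"
  shows "wlim4 A a b d c (\<lambda>p q s r. rform x' p q r s) = wlim4 A a b c d (rform x')"
proof (intro wlim_cong)
  fix p q assume p: "p \<in> carr A" and q: "q \<in> carr A"
  have f: "form3 A (rform x' p)" "form2 A (rform x' p q)"
    using form4_apply[OF A form4_rform[OF x'] p] form3_apply[OF A _ q] by auto
  have "wlim3 A (emb A q) c d (rform x' p) = wlim2 A c d (rform x' p q)" if "d \<in> carr (bidual A)" for d
    by (intro wlim_emb form2_wlim form3_wlim f A q c that)
  then have "bap (badj4 \<pi>2) (emb (dual X) x') (tap (tadj4 D) (emb A p) (emb A q) c)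
      = zext (bidual A) (\<lambda>d. wlim2 A c d (rform x' p q))"
    unfolding badj4_right_D4_value[OF x' p emb_mem[OF A q] c] by (intro zext_cong)
  then have "zext (bidual A) (\<lambda>d. wlim2 A c d (rform x' p q)) \<in> canon (dual A)"
    using C1[unfolded cond1_iff, unfolded bvals_subset_iff ball_tvals ball_canon, rule_format, OF x' p q c]
    by simp
  then show "wlim2 A d c (\<lambda>s r. rform x' p q r s) = wlim2 A c d (rform x' p q)"
    using wlim2_mem_canon_iff[OF A c f(2)] d by simp
qed

end

theorem theorem4p3:
  fixes A :: "('k::real_normed_field, 'a::ab_group_add) nspace"
    and X :: "('k, 'x::ab_group_add) nspace"
    and \<pi> :: "('k, 'a, 'a, 'a) bimap"
    and \<pi>1 :: "('k, 'a, 'x, 'x) bimap"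
    and \<pi>2 :: "('k, 'x, 'a, 'x) bimap"
    and D :: "('k, 'a, 'a, 'a, 'x) trimap"
  assumes "banach_algebra A \<pi>"
    and "banach_module A \<pi> \<pi>1 X \<pi>2"
    and "D \<in> bounded_trilinear_maps A A A X"
    and "tri_derivation A \<pi> \<pi>1 \<pi>2 D"
  shows "tri_derivation (bidual A) (badj3 \<pi>) (badj3 \<pi>1) (badj3 \<pi>2) (tadj4 D) \<longleftrightarrow>
    bvals (badj (bflip (badj (badj \<pi>2))))
        (tvals (tadj4 D) (canon A) (canon A) (carr (bidual A))) (carr (dual X))
      \<subseteq> canon (dual A) \<and>
    bvals (badj4 \<pi>2) (canon (dual X))
        (tvals (tadj4 D) (canon A) (carr (bidual A)) (carr (bidual A)))
      \<subseteq> canon (dual A) \<and>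
    tvals (tadj (tflip (tadj4 D)))
        (bvals (badj4 \<pi>1) (canon (dual X)) (carr (bidual A)))
        (carr (bidual A)) (carr (bidual A))
      \<subseteq> canon (dual A) \<and>
    tvals (tadj6 D) (canon (bidual A))
        (bvals (badj4 \<pi>1) (canon (dual X)) (carr (bidual A))) (canon A)
      \<subseteq> canon (dual A) \<and>
    tvals (tadj7 D) (canon (bidual A)) (canon (bidual A))
        (bvals (badj4 \<pi>1) (canon (dual X)) (carr (bidual A)))
      \<subseteq> canon (dual A)"
    (is "?T \<longleftrightarrow> ?C1 \<and> ?C2 \<and> ?C3 \<and> ?C4 \<and> ?C5")
proof -
  interpret banach_module_tri_derivation A X \<pi> \<pi>1 \<pi>2 D
    using assms by unfold_locales
  let ?A = "carr (bidual A)" and ?X = "carr (dual X)"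
  \<comment> \<open>After \<open>cond1_iff\<close> only the inclusion of \<open>A\<close> in its
    second dual is needed, in the second argument of \<open>tadj4 D\<close>.\<close>
  have C1_if_C2: "?C2 \<Longrightarrow> ?C1"
    unfolding cond1_iff using emb_mem[OF A]
    by (auto simp: bvals_subset_iff ball_tvals ball_canon)
  have C3: "?C3 \<longleftrightarrow> (\<forall>x'\<in>?X. \<forall>d\<in>?A. \<forall>c\<in>?A. \<forall>b\<in>?A. \<forall>a\<in>?A.
      wlim4 A d a b c (lform x') = wlim4 A a d b c (\<lambda>q p r s. lform x' p q r s))"
    by (simp add: tvals_subset_iff ball_bvals ball_canon tflip_D4_value wlim4_lform_mem_canon_iff1)
  have C5: "?C5 \<longleftrightarrow> ?C3"
    by (auto simp: tvals_subset_iff ball_bvals ball_canon tflip_D4_value D7_value)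
  have C4: "?C4 \<longleftrightarrow> (\<forall>c\<in>?A. \<forall>x'\<in>?X. \<forall>d\<in>?A. \<forall>q\<in>carr A. \<forall>b\<in>?A.
      wlim3 A d b c (\<lambda>p. lform x' p q) = wlim3 A b d c (\<lambda>r p s. lform x' p q r s))"
    by (simp add: tvals_subset_iff ball_bvals ball_canon D6_value emb_mem[OF A]
        wlim4_lform_mem_canon_iff2)
  show ?thesis
  proof
    assume ?T
    note T = this[unfolded tri_derivation_D4_iff, rule_format]
    \<comment> \<open>The first identity at \<open>emb A p\<close>: the limit along a constant net
      drops out on both sides.\<close>
    have "wlim3 A b c d (rform x' p) = wlim3 A d b c (\<lambda>s q r. rform x' p q r s)"
      if "x' \<in> ?X" "p \<in> carr A" "b \<in> ?A" "c \<in> ?A" "d \<in> ?A" for x' p b c d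
      using T[OF emb_mem[OF A that(2)] that(3,4,5,1)] wlim4_rform_emb[OF that]
        wlim4_rform_emb_swap[OF that] by simp
    then have ?C2
      unfolding cond2_iff by blast
    moreover have ?C3
      unfolding C3
    proof (intro ballI)
      fix x' d c b a assume *: "x' \<in> ?X" "d \<in> ?A" "c \<in> ?A" "b \<in> ?A" "a \<in> ?A"
      \<comment> \<open>Condition (1) makes the \<open>rform\<close> terms of the second identity,
        taken with \<open>b\<close> and \<open>d\<close> exchanged, cancel; the remaining terms are
        condition (3).\<close>
      have "wlim4 A a d b c (\<lambda>p q s r. rform x' p q r s) = wlim4 A a d c b (rform x')"
        using wlim4_rform_swap34[OF C1_if_C2[OF \<open>?C2\<close>]] * by blast
      then show "wlim4 A d a b c (lform x') = wlim4 A a d b c (\<lambda>q p r s. lform x' p q r s)"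
        using T[OF *(5,2,3,4,1)] by simp
    qed
    moreover have ?C4
      unfolding C4
    proof (intro ballI)
      fix c x' d q b assume *: "c \<in> ?A" "x' \<in> ?X" "d \<in> ?A" "q \<in> carr A" "b \<in> ?A"
      \<comment> \<open>The third identity with \<open>emb A q\<close> for \<open>a\<close> and with
        \<open>c\<close> and \<open>d\<close> exchanged.\<close>
      show "wlim3 A d b c (\<lambda>p. lform x' p q) = wlim3 A b d c (\<lambda>r p s. lform x' p q r s)"
        using T[OF emb_mem[OF A *(4)] *(5,3,1,2)] wlim4_lform_emb[OF *(2,4,3,5,1)]
          wlim4_lform_emb_swap[OF *(2,4,5,3,1)] by simp
    qed
    ultimately show "?C1 \<and> ?C2 \<and> ?C3 \<and> ?C4 \<and> ?C5"
      using C1_if_C2 C5 by blast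
  next
    assume "?C1 \<and> ?C2 \<and> ?C3 \<and> ?C4 \<and> ?C5"
    then have C: ?C1 ?C2 ?C3 ?C4 by blast+
    show ?T
      unfolding tri_derivation_D4_iff
    proof (intro ballI conjI)
      fix a b c d x'
      assume a: "a \<in> ?A" and b: "b \<in> ?A" and c: "c \<in> ?A" and d: "d \<in> ?A" and x': "x' \<in> ?X"
      show "wlim4 A a d b c (\<lambda>p s q r. rform x' p q r s) = wlim4 A a b c d (rform x')"
        using C(2)[unfolded cond2_iff] b c d x' by (intro wlim_cong) simp
      show "wlim4 A a b d c (\<lambda>p q s r. rform x' p q r s) + wlim4 A a b d c (\<lambda>q p r s. lform x' p q r s)
          = wlim4 A a b c d (rform x') + wlim4 A b a d c (lform x')"
        using wlim4_rform_swap34[OF C(1) x' a b c d] C(3)[unfolded C3] a b c d x' by simp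
      \<comment> \<open>The limit along \<open>c\<close> has to move to the front. Under the limit
        along \<open>a\<close>, condition (4) moves it past \<open>b\<close>; condition (3) then
        moves it past \<open>a\<close>.\<close>
      have "wlim4 A a b c d (\<lambda>q r p s. lform x' p q r s) = wlim4 A a c b d (\<lambda>q p r s. lform x' p q r s)"
        using C(4)[unfolded C4] b c d x' by (intro wlim_cong) simp
      then show "wlim4 A a b c d (\<lambda>q r p s. lform x' p q r s) = wlim4 A c a b d (lform x')"
        using C(3)[unfolded C3] a b c d x' by simp
    qed
  qed
qed

end
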